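(* Let $G$ be a split-comparability graph whose vertex set is partitioned as $V(G) = Q \cup S$, where $Q$ is a maximal clique, $S$ is a stable set, and both $Q$ and $S$ are non-empty. Then $G$ is Class 2 (that is, $\chi'(G) = \Delta(G)+1$) if and only if $G$ is neighborhood-overfull.
   Context: All graphs are finite, simple and undirected. $\Delta(G)$ denotes the maximum degree of $G$. The chromatic index $\chi'(G)$ is the least $k$ such that the edges of $G$ can be colored with $k$ colors so that adjacent edges receive distinct colors. By Vizing's theorem $\chi'(G) \in \{\Delta(G), \Delta(G)+1\}$; $G$ is Class 1 if $\chi'(G)=\Delta(G)$ and Class 2 if $\chi'(G)=\Delta(G)+1$. A graph $H$ with $n$ vertices and $m$ edges is overfull if $n$ is odd and $m > (n-1)\Delta(H)/2$. A $\Delta(G)$-vertex is a vertex of degree $\Delta(G)$. $N[v]$ denotes the closed neighborhood of $v$ (the vertex $v$ together with its neighbors), and $G[X]$ denotes the subgraph of $G$ induced by $X \subseteq V(G)$. A graph $G$ is neighborhood-overfull if for some $\Delta(G)$-vertex $v$, the graph $G[N[v]]$ is overfull. A clique is a set of pairwise adjacent vertices; it is maximal if no other clique contains it. A stable set is a set of pairwise non-adjacent vertices. A graph is a split graph if its vertex set can be partitioned into a clique $Q$ and a stable set $S$. A graph is a comparability graph if its edges admit a transitive orientation, i.e. an orientation such that whenever the directed edges $(x,y)$ and $(y,z)$ exist, so does $(x,z)$. A split-comparability graph is a graph that is both a split graph and a comparability graph. *)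

theory Defs
  imports Complex_Main
begin

record 'a graph =
  verts :: "'a set"
  edges :: "'a set set"

definition finite_simple_graph :: "'a graph \<Rightarrow> bool" where
  "finite_simple_graph G \<longleftrightarrow>
     finite (verts G) \<and> (\<forall>e\<in>edges G. e \<subseteq> verts G \<and> card e = 2)"

definition adjacent :: "'a graph \<Rightarrow> 'a \<Rightarrow> 'a \<Rightarrow> bool" where
  "adjacent G x y \<longleftrightarrow> {x, y} \<in> edges G"

definition degree :: "'a graph \<Rightarrow> 'a \<Rightarrow> nat" where
  "degree G v = card {e \<in> edges G. v \<in> e}"

(* The inserted 0 only fixes the value of the graph without vertices. *)
definition max_degree :: "'a graph \<Rightarrow> nat" where
  "max_degree G = Max (insert 0 (degree G ` verts G))"

definition edge_coloring :: "'a graph \<Rightarrow> nat \<Rightarrow> ('a set \<Rightarrow> nat) \<Rightarrow> bool" where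
  "edge_coloring G k c \<longleftrightarrow>
     c ` edges G \<subseteq> {..<k} \<and>
     (\<forall>e\<in>edges G. \<forall>f\<in>edges G. e \<noteq> f \<and> e \<inter> f \<noteq> {} \<longrightarrow> c e \<noteq> c f)"

definition chromatic_index :: "'a graph \<Rightarrow> nat" where
  "chromatic_index G = (LEAST k. \<exists>c. edge_coloring G k c)"

definition class_2 :: "'a graph \<Rightarrow> bool" where
  "class_2 G \<longleftrightarrow> chromatic_index G = max_degree G + 1"

definition overfull :: "'a graph \<Rightarrow> bool" where
  "overfull H \<longleftrightarrow>
     odd (card (verts H)) \<and>
     real (card (edges H)) > (real (card (verts H)) - 1) * real (max_degree H) / 2"

definition closed_neighborhood :: "'a graph \<Rightarrow> 'a \<Rightarrow> 'a set" where
  "closed_neighborhood G v = insert v {u \<in> verts G. adjacent G v u}"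

definition induced_subgraph :: "'a graph \<Rightarrow> 'a set \<Rightarrow> 'a graph" where
  "induced_subgraph G X = \<lparr>verts = X, edges = {e \<in> edges G. e \<subseteq> X}\<rparr>"

definition neighborhood_overfull :: "'a graph \<Rightarrow> bool" where
  "neighborhood_overfull G \<longleftrightarrow>
     (\<exists>v\<in>verts G. degree G v = max_degree G \<and>
        overfull (induced_subgraph G (closed_neighborhood G v)))"

definition clique :: "'a graph \<Rightarrow> 'a set \<Rightarrow> bool" where
  "clique G Q \<longleftrightarrow> Q \<subseteq> verts G \<and> pairwise (adjacent G) Q"

definition maximal_clique :: "'a graph \<Rightarrow> 'a set \<Rightarrow> bool" where
  "maximal_clique G Q \<longleftrightarrow> clique G Q \<and> (\<nexists>Q'. clique G Q' \<and> Q \<subset> Q')"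

definition stable_set :: "'a graph \<Rightarrow> 'a set \<Rightarrow> bool" where
  "stable_set G S \<longleftrightarrow> S \<subseteq> verts G \<and> pairwise (\<lambda>x y. \<not> adjacent G x y) S"

definition split_graph :: "'a graph \<Rightarrow> bool" where
  "split_graph G \<longleftrightarrow>
     (\<exists>Q S. verts G = Q \<union> S \<and> Q \<inter> S = {} \<and> clique G Q \<and> stable_set G S)"

(* D picks exactly one of the two ordered pairs of each edge, and nothing else. *)
definition orientation :: "'a graph \<Rightarrow> ('a \<times> 'a) set \<Rightarrow> bool" where
  "orientation G D \<longleftrightarrow>
     (\<forall>x y. (x, y) \<in> D \<longrightarrow> adjacent G x y) \<and>
     (\<forall>x y. adjacent G x y \<longrightarrow> ((x, y) \<in> D \<longleftrightarrow> (y, x) \<notin> D))"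

definition comparability_graph :: "'a graph \<Rightarrow> bool" where
  "comparability_graph G \<longleftrightarrow> (\<exists>D. orientation G D \<and> trans D)"

definition split_comparability_graph :: "'a graph \<Rightarrow> bool" where
  "split_comparability_graph G \<longleftrightarrow> split_graph G \<and> comparability_graph G"

end

theory Submission
  imports Defs
begin

text \<open>
  Let \<open>Q\<close> be the clique and \<open>S\<close> the stable set. In a transitive orientation no vertex of \<open>Q\<close> has
  both an arc into \<open>S\<close> and an arc from \<open>S\<close>. Let \<open>A\<close> be the vertices of \<open>Q\<close> with an arc into \<open>S\<close>
  and \<open>B\<close> those with an arc from \<open>S\<close>, and let \<open>SA\<close> and \<open>SB\<close> be their neighbors in \<open>S\<close>. Within
  \<open>A\<close>, and within \<open>B\<close>, the neighborhoods in \<open>S\<close> form a chain, so unless \<open>A\<close> is empty, some \<open>v\<close>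
  in \<open>A\<close> is adjacent to all of \<open>SA\<close>, and likewise for \<open>B\<close>. Let \<open>SA\<close> be at least as large as
  \<open>SB\<close>. Then \<open>\<Delta> = |Q| - 1 + |SA|\<close>, attained at such a \<open>v\<close>, and the closed neighborhood \<open>Q \<union> SA\<close>
  of \<open>v\<close> has \<open>\<Delta> + 1\<close> vertices.

  The main device is to fold \<open>G\<close> onto \<open>Q \<union> SA\<close> by identifying the vertices of \<open>SB - SA\<close> with
  different vertices of \<open>SA - SB\<close>. A vertex of \<open>Q\<close> never sees two vertices that are identified,
  so an edge coloring of the complete graph on \<open>Q \<union> SA\<close> pulls back to \<open>G\<close>. A complete graph on
  at most \<open>K + 1\<close> vertices has a \<open>K\<close>-coloring when \<open>K\<close> is odd. This gives \<open>\<Delta>\<close> colors for odd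
  \<open>\<Delta>\<close>, and \<open>\<Delta> + 1\<close> colors for even \<open>\<Delta>\<close> (\<open>odd_edge_coloring\<close>). An overfull neighborhood has an
  odd number \<open>\<Delta> + 1\<close> of vertices and, as color classes are matchings, too many edges for \<open>\<Delta>\<close>
  colors.

  It remains to color \<open>G\<close> with \<open>\<Delta> = 2h\<close> colors when \<open>Q \<union> SA\<close> spans at least \<open>h\<close> non-edges
  (\<open>even_edge_coloring\<close>). This rests on a case of Plantholt's theorem: the complete graph on
  \<open>2h + 1\<close> vertices with a set \<open>E\<close> of \<open>h\<close> edges removed is \<open>2h\<close>-colorable, provided that \<open>E\<close>
  covers at most \<open>h + 1\<close> vertices. The covered vertices are few enough to be colored greedily,
  with a reserved color for each end of each edge of \<open>E\<close> that this end is to miss; the other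
  vertices are universal and are added one at a time with Hall's theorem
  (\<open>extend_by_universal_vertices\<close>). The bound \<open>h + 1\<close> comes for free because the non-edges at
  hand form a connected graph.

  If at least \<open>h\<close> non-edges survive the folding, they provide \<open>E\<close>. If not, some edges of \<open>G\<close>
  must not be folded: their would-be images are put into \<open>E\<close>, and each such edge takes the color
  reserved at its end in \<open>Q\<close>. Reserved colors are all different, so a conflict can arise only at
  a vertex \<open>t\<close> of \<open>SB - SA\<close> with some edges folded and others not. One such vertex is enough,
  and the conflict is avoided by folding it onto a vertex \<open>j\<close> of \<open>SA - SB\<close> with at least as many
  neighbors. When \<open>SA\<close> and \<open>SB\<close> have equal size, \<open>j\<close> may be sought on either side, and this is
  the place where the neighborhoods of both kinds of vertices of degree \<open>\<Delta>\<close> have to be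
  considered.
\<close>

section \<open>Matchings in bipartite graphs\<close>

text \<open>
  The Halmos--Vaughan argument. A nonempty proper subfamily without surplus is matched into
  exactly its own neighbors, which can then be deleted for everyone else; if all of these
  have a surplus, any single choice can be made first.
\<close>
theorem hall_marriage:
  assumes "finite I" and "\<And>i. i \<in> I \<Longrightarrow> finite (N i)"
    and "\<And>J. J \<subseteq> I \<Longrightarrow> card J \<le> card (\<Union>i\<in>J. N i)"
  shows "\<exists>f. inj_on f I \<and> (\<forall>i\<in>I. f i \<in> N i)"
  using assms
proof (induction I arbitrary: N rule: finite_psubset_induct)
  case (psubset I)
  note fin = psubset.prems(1) and hall = psubset.prems(2)
  show ?case
  proof (cases "\<exists>J. J \<subset> I \<and> J \<noteq> {} \<and> card (\<Union>i\<in>J. N i) \<le> card J")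
    case True
    then obtain J where J: "J \<subset> I" "J \<noteq> {}" "card (\<Union>i\<in>J. N i) \<le> card J" by blast
    let ?U = "\<Union>i\<in>J. N i"
    obtain f1 where f1: "inj_on f1 J" "\<forall>i\<in>J. f1 i \<in> N i"
      using psubset.IH[of J N] J fin hall by (meson order.trans psubsetE subsetD)
    have "card K \<le> card (\<Union>i\<in>K. N i - ?U)" if K: "K \<subseteq> I - J" for K
    proof -
      have "card K + card J = card (K \<union> J)"
        using K J psubset.hyps by (intro card_Un_disjoint[symmetric]) (auto intro: finite_subset)
      also have "\<dots> \<le> card (\<Union>i\<in>K \<union> J. N i)" using hall[of "K \<union> J"] K J by blast
      also have "(\<Union>i\<in>K \<union> J. N i) = (\<Union>i\<in>K. N i - ?U) \<union> ?U" by blast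
      also have "card \<dots> \<le> card (\<Union>i\<in>K. N i - ?U) + card ?U" by (rule card_Un_le)
      finally show ?thesis using J(3) by linarith
    qed
    moreover have "I - J \<subset> I" using J by blast
    ultimately obtain f2 where f2: "inj_on f2 (I - J)" "\<forall>i\<in>I - J. f2 i \<in> N i - ?U"
      using psubset.IH[of "I - J" "\<lambda>i. N i - ?U"] fin by auto
    define f where "f i = (if i \<in> J then f1 i else f2 i)" for i
    have "inj_on f I"
    proof (rule inj_onI)
      fix i k assume ik: "i \<in> I" "k \<in> I" "f i = f k"
      have "f z \<in> ?U \<longleftrightarrow> z \<in> J" if "z \<in> I" for z
        using that f1(2) f2(2) unfolding f_def by auto
      then have "i \<in> J \<longleftrightarrow> k \<in> J" using ik by metis
      then show "i = k"
        using ik f1(1) f2(1) unfolding f_def by (auto dest: inj_onD split: if_splits)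
    qed
    moreover have "\<forall>i\<in>I. f i \<in> N i" using f1 f2 unfolding f_def by auto
    ultimately show ?thesis by blast
  next
    case False
    show ?thesis
    proof (cases "I = {}")
      case True then show ?thesis by simp
    next
      case False': False
      then obtain i where i: "i \<in> I" by blast
      have "card {i} \<le> card (\<Union>i\<in>{i}. N i)" using hall[of "{i}"] i by blast
      then have "N i \<noteq> {}" by auto
      then obtain x where x: "x \<in> N i" by blast
      have "card J \<le> card (\<Union>k\<in>J. N k - {x})" if J: "J \<subseteq> I - {i}" for J
      proof (cases "J = {}")
        case False2: False
        have "J \<subset> I" using J i by blast
        then have "card J < card (\<Union>k\<in>J. N k)" using False False2 by (meson not_le)
        moreover have "(\<Union>k\<in>J. N k - {x}) = (\<Union>k\<in>J. N k) - {x}" by blast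
        ultimately show ?thesis
          by (auto simp: card_Diff_singleton_if)
      qed simp
      moreover have "I - {i} \<subset> I" using i by blast
      ultimately obtain f where f: "inj_on f (I - {i})" "\<forall>k\<in>I - {i}. f k \<in> N k - {x}"
        using psubset.IH[of "I - {i}" "\<lambda>k. N k - {x}"] fin by auto
      have "inj_on (f(i := x)) I"
        using f unfolding inj_on_def by auto
      moreover have "\<forall>k\<in>I. (f(i := x)) k \<in> N k" using f x by auto
      ultimately show ?thesis by blast
    qed
  qed
qed

text \<open>
  Adding \<open>card C - card X\<close> dummy vertices joined to all of \<open>C\<close> except the vertices of full
  degree \<open>d\<close> turns a matching that saturates the left side into a bijection onto \<open>C\<close>, in which
  the vertices of degree \<open>d\<close> can only be met by elements of \<open>X\<close>. Hall's condition holds because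
  the full-degree vertices missed by a subset \<open>A\<close> of \<open>X\<close> have all their \<open>d\<close> neighbors in
  \<open>X - A\<close>.
\<close>
lemma matching_saturating_max_degree:
  fixes N :: "'a \<Rightarrow> 'b set"
  assumes "finite X" "finite C" "0 < d"
    and N: "\<And>x. x \<in> X \<Longrightarrow> N x \<subseteq> C" and deg: "\<And>x. x \<in> X \<Longrightarrow> card (N x) = d"
    and codeg: "\<And>k. k \<in> C \<Longrightarrow> card {x \<in> X. k \<in> N x} \<le> d"
  shows "\<exists>f. inj_on f X \<and> (\<forall>x\<in>X. f x \<in> N x) \<and>
             (\<forall>k\<in>C. card {x \<in> X. k \<in> N x} = d \<longrightarrow> k \<in> f ` X)"
proof -
  have count: "card A * d = (\<Sum>k\<in>C. card {x \<in> A. k \<in> N x})" if "A \<subseteq> X" for A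
  proof -
    have "finite A" using that assms(1) finite_subset by blast
    have "(\<Sum>x\<in>A. card {k \<in> C. k \<in> N x}) = (\<Sum>k\<in>C. card {x \<in> A. k \<in> N x})"
      using sum.swap_restrict[OF \<open>finite A\<close> assms(2), of "\<lambda>_ _. 1::nat" "\<lambda>x k. k \<in> N x"] by simp
    moreover have "card {k \<in> C. k \<in> N x} = d" if "x \<in> A" for x
      using N[of x] deg[of x] that \<open>A \<subseteq> X\<close> by (metis Collect_conj_eq Collect_mem_eq inf.absorb2 subsetD)
    ultimately show ?thesis by simp
  qed
  have expand: "card A \<le> card (\<Union>x\<in>A. N x)" if "A \<subseteq> X" for A
  proof -
    have sub: "(\<Union>x\<in>A. N x) \<subseteq> C" using that N by blast
    have "card A * d = (\<Sum>k\<in>C. card {x \<in> A. k \<in> N x})" by (rule count[OF that])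
    also have "\<dots> = (\<Sum>k\<in>(\<Union>x\<in>A. N x). card {x \<in> A. k \<in> N x})"
    proof (rule sum.mono_neutral_right[OF assms(2) sub], intro ballI)
      fix k assume "k \<in> C - (\<Union>x\<in>A. N x)"
      then have "{x \<in> A. k \<in> N x} = {}" by blast
      then show "card {x \<in> A. k \<in> N x} = 0" by (metis card.empty)
    qed
    also have "\<dots> \<le> (\<Sum>k\<in>(\<Union>x\<in>A. N x). d)"
    proof (rule sum_mono)
      fix k assume "k \<in> (\<Union>x\<in>A. N x)"
      then have "k \<in> C" using sub by blast
      moreover have "card {x \<in> A. k \<in> N x} \<le> card {x \<in> X. k \<in> N x}"
        using that assms(1) by (intro card_mono) auto
      ultimately show "card {x \<in> A. k \<in> N x} \<le> d" using codeg le_trans by blast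
    qed
    also have "\<dots> = card (\<Union>x\<in>A. N x) * d" by simp
    finally show ?thesis using assms(3) by simp
  qed
  have XC: "card X \<le> card C"
    using expand[of X] card_mono[OF assms(2), of "\<Union>x\<in>X. N x"] N by force
  define T where "T = {k \<in> C. card {x \<in> X. k \<in> N x} = d}"
  define N' where "N' z = (case z of Inl x \<Rightarrow> N x | Inr (i::nat) \<Rightarrow> C - T)" for z
  define I where "I = Inl ` X \<union> Inr ` {..<card C - card X}"
  have finI: "finite I" unfolding I_def using assms(1) by simp
  have cardI: "card I = card C"
    unfolding I_def using assms(1) XC
    by (subst card_Un_disjoint) (auto simp: card_image inj_on_def)
  have "\<exists>f. inj_on f I \<and> (\<forall>i\<in>I. f i \<in> N' i)"
  proof (rule hall_marriage[OF finI])
    fix z assume "z \<in> I"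
    then show "finite (N' z)"
      using finite_subset[OF N assms(2)] assms(2) unfolding N'_def I_def by auto
  next
    fix J assume J: "J \<subseteq> I"
    define A where "A = {x. Inl x \<in> J}"
    have AX: "A \<subseteq> X" using J unfolding A_def I_def by auto
    have finA: "finite A" using AX assms(1) finite_subset by blast
    show "card J \<le> card (\<Union>z\<in>J. N' z)"
    proof (cases "\<exists>i. Inr i \<in> J")
      case False
      then have "J = Inl ` A" unfolding A_def using J I_def by auto
      then have "card J = card A" "(\<Union>z\<in>J. N' z) = (\<Union>x\<in>A. N x)"
        by (auto simp: card_image N'_def)
      then show ?thesis using expand[OF AX] by simp
    next
      case True
      have eq: "(\<Union>z\<in>J. N' z) = (C - T) \<union> (\<Union>x\<in>A. N x)"
      proof
        show "(\<Union>z\<in>J. N' z) \<subseteq> (C - T) \<union> (\<Union>x\<in>A. N x)"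
          unfolding N'_def A_def by (auto split: sum.splits)
        show "(C - T) \<union> (\<Union>x\<in>A. N x) \<subseteq> (\<Union>z\<in>J. N' z)"
          using True unfolding N'_def A_def by force
      qed
      have sub: "(\<Union>z\<in>J. N' z) \<subseteq> C" using N AX unfolding eq by blast
      let ?T' = "C - (\<Union>z\<in>J. N' z)"
      have finT': "finite ?T'" using assms(2) by simp
      (* the maximum-degree elements that A misses have all their neighbors in X - A *)
      have "card ?T' * d = (\<Sum>k\<in>?T'. card {x \<in> X - A. k \<in> N x})"
      proof -
        have "card {x \<in> X - A. k \<in> N x} = d" if "k \<in> ?T'" for k
        proof -
          have "{x \<in> X - A. k \<in> N x} = {x \<in> X. k \<in> N x}" using that unfolding eq by blast
          then show ?thesis using that unfolding eq T_def by auto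
        qed
        then show ?thesis by simp
      qed
      also have "\<dots> \<le> (\<Sum>k\<in>C. card {x \<in> X - A. k \<in> N x})"
        by (rule sum_mono2[OF assms(2)]) auto
      also have "\<dots> = card (X - A) * d" by (rule count[symmetric]) blast
      finally have le: "card ?T' \<le> card (X - A)" using assms(3) by simp
      have "card J \<le> card (Inl ` A \<union> Inr ` {..<card C - card X})"
        using J finA unfolding A_def I_def by (intro card_mono) auto
      also have "\<dots> = card A + (card C - card X)"
        using finA by (subst card_Un_disjoint) (auto simp: card_image inj_on_def)
      finally have "card J \<le> card A + (card C - card X)" .
      moreover have "card ?T' = card C - card (\<Union>z\<in>J. N' z)"
        using sub assms(2) by (intro card_Diff_subset) (auto intro: finite_subset)
      moreover have "card (X - A) = card X - card A" using AX finA by (rule card_Diff_subset[rotated])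
      moreover have "card (\<Union>z\<in>J. N' z) \<le> card C" using sub assms(2) by (rule card_mono[rotated])
      moreover have "card A \<le> card X" using AX assms(1) by (rule card_mono[rotated])
      ultimately show ?thesis using le XC by linarith
    qed
  qed
  then obtain f where f: "inj_on f I" "\<And>z. z \<in> I \<Longrightarrow> f z \<in> N' z" by blast
  have "f ` I \<subseteq> C" using f(2) N unfolding I_def N'_def by fastforce
  then have surj: "f ` I = C"
    using f(1) cardI assms(2) by (metis card_image card_subset_eq)
  have "k \<in> (f \<circ> Inl) ` X" if "k \<in> T" for k
  proof -
    have "k \<in> f ` I" using that surj unfolding T_def by blast
    then obtain z where z: "z \<in> I" "k = f z" by blast
    then show ?thesis
      using f(2)[of z] that unfolding I_def N'_def by auto
  qed
  moreover have "inj_on (f \<circ> Inl) X"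
    using f(1) unfolding I_def inj_on_def by auto
  moreover have "\<forall>x\<in>X. (f \<circ> Inl) x \<in> N x" using f(2) unfolding I_def N'_def by fastforce
  ultimately show ?thesis unfolding T_def by blast
qed

section \<open>Proper edge colorings\<close>

definition pairs :: "'a set \<Rightarrow> 'a set set" where
  "pairs X = {e. e \<subseteq> X \<and> card e = 2}"

definition proper_on :: "'a set set \<Rightarrow> ('a set \<Rightarrow> nat) \<Rightarrow> bool" where
  "proper_on E c \<longleftrightarrow> (\<forall>e\<in>E. \<forall>f\<in>E. e \<noteq> f \<and> e \<inter> f \<noteq> {} \<longrightarrow> c e \<noteq> c f)"

lemma pairs_iff: "e \<in> pairs X \<longleftrightarrow> (\<exists>x\<in>X. \<exists>y\<in>X. x \<noteq> y \<and> e = {x, y})"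
  unfolding pairs_def by (auto simp: card_2_iff)

lemma doubleton_in_pairs [simp]: "{x, y} \<in> pairs X \<longleftrightarrow> x \<in> X \<and> y \<in> X \<and> x \<noteq> y"
  unfolding pairs_def by (auto simp: card_2_iff')

lemma finite_pairs: "finite X \<Longrightarrow> finite (pairs X)"
  unfolding pairs_def by simp

lemma card_pairs: "finite X \<Longrightarrow> card (pairs X) = card X choose 2"
  unfolding pairs_def by (rule n_subsets)

lemma pairs_mono: "X \<subseteq> Y \<Longrightarrow> pairs X \<subseteq> pairs Y"
  unfolding pairs_def by blast

lemma pairs_other_end:
  assumes "e \<in> pairs X" "x \<in> e"
  obtains y where "e = {x, y}" "y \<in> X" "y \<noteq> x" "x \<in> X"
  using assms unfolding pairs_iff by fastforce

lemma proper_onD: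
  "proper_on E c \<Longrightarrow> e \<in> E \<Longrightarrow> f \<in> E \<Longrightarrow> c e = c f \<Longrightarrow> x \<in> e \<Longrightarrow> x \<in> f \<Longrightarrow> e = f"
  unfolding proper_on_def by blast

lemma card_Union_color_class:
  assumes "finite E" "\<And>e. e \<in> E \<Longrightarrow> card e = 2" "proper_on E c"
  shows "card (\<Union>{e \<in> E. c e = k}) = 2 * card {e \<in> E. c e = k}"
proof -
  have "card (\<Union>{e \<in> E. c e = k}) = sum card {e \<in> E. c e = k}"
    using assms unfolding proper_on_def pairwise_def disjnt_def
    by (intro card_Union_disjoint) (auto simp: pairwise_def disjnt_def intro: card_ge_0_finite)
  also have "\<dots> = (\<Sum>e\<in>{e \<in> E. c e = k}. 2)" using assms(2) by (intro sum.cong) auto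
  finally show ?thesis by simp
qed

lemma card_star:
  assumes "finite E" "\<And>e. e \<in> E \<Longrightarrow> card e = 2"
  shows "card {e \<in> E. x \<in> e} = card {y. y \<noteq> x \<and> {x, y} \<in> E}"
proof -
  have "{e \<in> E. x \<in> e} = (\<lambda>y. {x, y}) ` {y. y \<noteq> x \<and> {x, y} \<in> E}"
  proof (intro equalityI subsetI)
    fix e assume "e \<in> {e \<in> E. x \<in> e}"
    then have "e \<in> pairs e" "x \<in> e" "e \<in> E" using assms(2) unfolding pairs_def by auto
    then obtain y where "e = {x, y}" "y \<noteq> x" by (meson pairs_other_end)
    then show "e \<in> (\<lambda>y. {x, y}) ` {y. y \<noteq> x \<and> {x, y} \<in> E}" using \<open>e \<in> E\<close> by blast
  qed auto
  moreover have "inj_on (\<lambda>y. {x, y}) {y. y \<noteq> x \<and> {x, y} \<in> E}"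
    by (auto simp: inj_on_def doubleton_eq_iff)
  ultimately show ?thesis by (simp add: card_image)
qed

text \<open>
  Edge by edge: an edge \<open>e\<close> avoids the colors of the edges that it meets and its own forbidden
  set \<open>B e\<close>, fewer than \<open>K\<close> colors altogether.
\<close>
lemma greedy_coloring:
  assumes "finite E" "E0 \<subseteq> E" "proper_on E0 c0" "c0 ` E0 \<subseteq> {..<K}"
    and slack: "\<And>e. e \<in> E - E0 \<Longrightarrow> card {f \<in> E. f \<noteq> e \<and> f \<inter> e \<noteq> {}} + card (B e) < K"
    and finB: "\<And>e. e \<in> E - E0 \<Longrightarrow> finite (B e)"
  shows "\<exists>c. proper_on E c \<and> c ` E \<subseteq> {..<K} \<and> (\<forall>e\<in>E0. c e = c0 e) \<and> (\<forall>e\<in>E - E0. c e \<notin> B e)"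
proof -
  have "\<exists>c. proper_on (E0 \<union> D) c \<and> c ` (E0 \<union> D) \<subseteq> {..<K} \<and> (\<forall>e\<in>E0. c e = c0 e) \<and> (\<forall>e\<in>D. c e \<notin> B e)"
    if "D \<subseteq> E - E0" for D
  proof -
    have "finite D" using that assms(1) by (meson finite_Diff finite_subset)
    then show ?thesis using that
    proof (induction D)
      case empty
      then show ?case using assms(3,4) by auto
    next
      case (insert e D)
      then obtain c where c: "proper_on (E0 \<union> D) c" "c ` (E0 \<union> D) \<subseteq> {..<K}"
        "\<forall>e\<in>E0. c e = c0 e" "\<forall>e\<in>D. c e \<notin> B e" by auto
      define F where "F = c ` {f \<in> E. f \<noteq> e \<and> f \<inter> e \<noteq> {}} \<union> B e"
      have e: "e \<in> E - E0" using insert.prems by blast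
      have "card F \<le> card (c ` {f \<in> E. f \<noteq> e \<and> f \<inter> e \<noteq> {}}) + card (B e)"
        unfolding F_def by (rule card_Un_le)
      also have "card (c ` {f \<in> E. f \<noteq> e \<and> f \<inter> e \<noteq> {}}) \<le> card {f \<in> E. f \<noteq> e \<and> f \<inter> e \<noteq> {}}"
        using assms(1) by (intro card_image_le) simp
      finally have "card F \<le> card {f \<in> E. f \<noteq> e \<and> f \<inter> e \<noteq> {}} + card (B e)" by simp
      then have "card F < card {..<K}" using slack[OF e] by simp
      moreover have "finite F" unfolding F_def using finB[OF e] assms(1) by simp
      ultimately obtain k where k: "k < K" "k \<notin> F"
        by (metis card_mono lessThan_iff not_le subsetI)
      have eq: "(c(e := k)) f = c f" if "f \<in> E0 \<union> D" for f
        using that insert.hyps e by auto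
      have "proper_on (E0 \<union> insert e D) (c(e := k))"
        unfolding proper_on_def
      proof (intro ballI impI)
        fix f g assume fg: "f \<in> E0 \<union> insert e D" "g \<in> E0 \<union> insert e D" "f \<noteq> g \<and> f \<inter> g \<noteq> {}"
        have k': "c f \<noteq> k" if "f \<in> E0 \<union> D" "f \<inter> e \<noteq> {}" "f \<noteq> e" for f
          using that k insert.prems assms(2) unfolding F_def by auto
        consider "f = e" "g \<in> E0 \<union> D" "g \<noteq> e" | "g = e" "f \<in> E0 \<union> D" "f \<noteq> e"
          | "f \<in> E0 \<union> D" "g \<in> E0 \<union> D" "f \<noteq> e" "g \<noteq> e"
          using fg by blast
        then show "(c(e := k)) f \<noteq> (c(e := k)) g"
        proof cases
          case 1
          then have "c g \<noteq> k" using k'[of g] fg by (simp add: Int_commute)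
          then show ?thesis using 1 by simp
        next
          case 2
          then have "c f \<noteq> k" using k'[of f] fg by simp
          then show ?thesis using 2 by simp
        next
          case 3
          then show ?thesis using fg c(1) unfolding proper_on_def by simp
        qed
      qed
      moreover have "(c(e := k)) ` (E0 \<union> insert e D) \<subseteq> {..<K}" using c(2) k(1) by auto
      moreover have "\<forall>f\<in>E0. (c(e := k)) f = c0 f" using eq c(3) by auto
      moreover have "\<forall>f\<in>insert e D. (c(e := k)) f \<notin> B f" using eq c(4) k unfolding F_def by auto
      ultimately show ?case by blast
    qed
  qed
  from this[of "E - E0"] show ?thesis using assms(2) by (simp add: Un_absorb1)
qed

section \<open>Extending a coloring by universal vertices\<close>

text \<open>
  Each color \<open>k\<close> is to miss a single vertex \<open>m k\<close> of the final graph. The vertices listed here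
  are those that still have to receive an edge of color \<open>k\<close>, from a vertex outside \<open>P\<close>.
\<close>
definition uncovered :: "'a set set \<Rightarrow> (nat \<Rightarrow> 'a) \<Rightarrow> 'a set \<Rightarrow> ('a set \<Rightarrow> nat) \<Rightarrow> nat \<Rightarrow> 'a set" where
  "uncovered E m P c k = {x \<in> P. x \<noteq> m k \<and> (\<forall>e\<in>pairs P - E. x \<in> e \<longrightarrow> c e \<noteq> k)}"

lemma card_pairs_at: "finite P \<Longrightarrow> x \<in> P \<Longrightarrow> card {e \<in> pairs P. x \<in> e} = card P - 1"
proof -
  assume a: "finite P" "x \<in> P"
  have "card {e \<in> pairs P. x \<in> e} = card {y. y \<noteq> x \<and> {x, y} \<in> pairs P}"
    using finite_pairs[OF a(1)] by (rule card_star) (simp add: pairs_def)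
  also have "{y. y \<noteq> x \<and> {x, y} \<in> pairs P} = P - {x}" using a by auto
  finally show ?thesis using a by simp
qed

lemma card_pairs_minus_at:
  assumes "finite P" "x \<in> P" "E \<subseteq> pairs P"
  shows "card {e \<in> pairs P - E. x \<in> e} + card {e \<in> E. x \<in> e} = card P - 1"
proof -
  have fin: "finite E" using assms finite_pairs finite_subset by blast
  have "card {e \<in> pairs P. x \<in> e} = card ({e \<in> pairs P - E. x \<in> e} \<union> {e \<in> E. x \<in> e})"
    using assms(3) by (intro arg_cong[where f = card]) blast
  also have "\<dots> = card {e \<in> pairs P - E. x \<in> e} + card {e \<in> E. x \<in> e}"
    using fin finite_pairs[OF assms(1)] by (intro card_Un_disjoint) auto
  finally show ?thesis using card_pairs_at[OF assms(1,2)] by simp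
qed

lemma card_uncovered_colors:
  assumes "finite P" "E \<subseteq> pairs P" "x \<in> P" "card P \<le> Suc K"
    and c: "proper_on (pairs P - E) c" "c ` (pairs P - E) \<subseteq> {..<K}"
    and m: "\<And>k e. k < K \<Longrightarrow> e \<in> pairs P - E \<Longrightarrow> m k \<in> e \<Longrightarrow> c e \<noteq> k"
    and miss: "card {k. k < K \<and> m k = x} = card {e \<in> E. x \<in> e}"
  shows "card {k. k < K \<and> x \<in> uncovered E m P c k} = Suc K - card P"
proof -
  let ?U = "{k. k < K \<and> x \<in> uncovered E m P c k}" and ?M = "{k. k < K \<and> m k = x}"
    and ?S = "{e \<in> pairs P - E. x \<in> e}"
  have "{..<K} = ?U \<union> (?M \<union> c ` ?S)"
    using c(2) assms(3) unfolding uncovered_def by auto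
  moreover have "card (?U \<union> (?M \<union> c ` ?S)) = card ?U + (card ?M + card (c ` ?S))"
  proof -
    have fin: "finite (c ` ?S)" using finite_pairs[OF assms(1)] by simp
    have "?M \<inter> c ` ?S = {}" using m by auto
    then have "card (?M \<union> c ` ?S) = card ?M + card (c ` ?S)"
      using fin by (intro card_Un_disjoint) auto
    moreover have "?U \<inter> (?M \<union> c ` ?S) = {}" unfolding uncovered_def by auto
    then have "card (?U \<union> (?M \<union> c ` ?S)) = card ?U + card (?M \<union> c ` ?S)"
      using fin by (intro card_Un_disjoint) auto
    ultimately show ?thesis by simp
  qed
  moreover have "card (c ` ?S) = card ?S"
    using c(1) by (intro card_image inj_onI) (auto dest: proper_onD)
  moreover have "card ?S + card {e \<in> E. x \<in> e} = card P - 1"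
    by (rule card_pairs_minus_at[OF assms(1,3,2)])
  moreover have "card P > 0" using assms(1,3) by (auto simp: card_gt_0_iff)
  ultimately have "K = card ?U + (card ?M + card ?S)" by (metis card_lessThan)
  moreover note \<open>card ?S + card {e \<in> E. x \<in> e} = card P - 1\<close> \<open>card P > 0\<close>
  ultimately show ?thesis using miss assms(4) by linarith
qed

text \<open>
  The vertices of \<open>P\<close> other than \<open>m k\<close> are either uncovered or paired up by the color class \<open>k\<close>.
\<close>
lemma parity_uncovered:
  assumes "finite P" "m k \<in> P"
    and c: "proper_on (pairs P - E) c"
    and m: "\<And>e. e \<in> pairs P - E \<Longrightarrow> m k \<in> e \<Longrightarrow> c e \<noteq> k"
  shows "even (card (uncovered E m P c k)) \<longleftrightarrow> odd (card P)"
proof -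
  let ?R = "uncovered E m P c k" and ?C = "\<Union>{e \<in> pairs P - E. c e = k}"
  have fin: "finite ?R" "finite ?C"
    using assms(1) unfolding uncovered_def pairs_def by (auto intro: finite_subset)
  have "P = insert (m k) (?R \<union> ?C)"
  proof (rule subset_antisym; rule subsetI)
    fix x assume "x \<in> P"
    then show "x \<in> insert (m k) (?R \<union> ?C)" unfolding uncovered_def by blast
  next
    fix x assume "x \<in> insert (m k) (?R \<union> ?C)"
    then show "x \<in> P" using assms(2) unfolding uncovered_def pairs_def by blast
  qed
  moreover have "card (insert (m k) (?R \<union> ?C)) = Suc (card (?R \<union> ?C))"
    using fin m by (intro card_insert_disjoint) (auto simp: uncovered_def)
  moreover have "card (?R \<union> ?C) = card ?R + card ?C"
    using fin by (intro card_Un_disjoint) (auto simp: uncovered_def)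
  moreover have "card ?C = 2 * card {e \<in> pairs P - E. c e = k}"
    using finite_pairs[OF assms(1)] c by (intro card_Union_color_class) (auto simp: pairs_def)
  ultimately have "card P = Suc (card ?R + 2 * card {e \<in> pairs P - E. c e = k})" by simp
  then show ?thesis by simp
qed

text \<open>
  The vertices outside \<open>P\<close> are adjacent to everything and are added one at a time. A new vertex
  \<open>y\<close> uses a different color for each old vertex \<open>x\<close>, chosen among the colors still due at \<open>x\<close>;
  these are \<open>card V - card P\<close> many for every \<open>x\<close>. The condition \<open>room\<close>, that no color is due at
  more vertices than are still to come, survives if \<open>y\<close> uses every color for which it is tight,
  and this is what \<open>matching_saturating_max_degree\<close> supplies. A color that is not tight falls
  short by at least two, by parity, and so leaves room for \<open>y\<close> itself.
\<close>
lemma extend_by_universal_vertices: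
  fixes V P :: "'a set"
  assumes "finite V" "odd (card V)" "K = card V - 1" "P \<subseteq> V" "E \<subseteq> pairs P"
    and "proper_on (pairs P - E) c" "c ` (pairs P - E) \<subseteq> {..<K}"
    and mP: "\<And>k. k < K \<Longrightarrow> m k \<in> P"
    and "\<And>k e. k < K \<Longrightarrow> e \<in> pairs P - E \<Longrightarrow> m k \<in> e \<Longrightarrow> c e \<noteq> k"
    and miss: "\<And>x. x \<in> P \<Longrightarrow> card {k. k < K \<and> m k = x} = card {e \<in> E. x \<in> e}"
    and room: "\<And>k. k < K \<Longrightarrow> card (uncovered E m P c k) \<le> card V - card P"
  shows "\<exists>c'. proper_on (pairs V - E) c' \<and> c' ` (pairs V - E) \<subseteq> {..<K} \<and>
     (\<forall>e\<in>pairs P - E. c' e = c e) \<and> (\<forall>k<K. \<forall>e\<in>pairs V - E. m k \<in> e \<longrightarrow> c' e \<noteq> k)"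
  using assms(4-)
proof (induction "card V - card P" arbitrary: P c)
  case 0
  then have "P = V" using assms(1) by (metis card_seteq diff_is_0_eq)
  then show ?case using 0 by blast
next
  case (Suc d)
  note PV = Suc.prems(1) and EP = Suc.prems(2) and prp = Suc.prems(3) and ran = Suc.prems(4)
    and mP = Suc.prems(5) and m = Suc.prems(6) and miss = Suc.prems(7) and room = Suc.prems(8)
  have finP: "finite P" using PV assms(1) finite_subset by blast
  have "P \<noteq> V" using Suc.hyps(2) by auto
  then obtain y where y: "y \<in> V" "y \<notin> P" using PV by blast
  have PK: "card P \<le> K" using Suc.hyps(2) assms(3) by linarith
  let ?R = "uncovered E m P c"
  have finR: "finite (?R k)" for k using finP unfolding uncovered_def by simp
  have deg: "card {k. k < K \<and> x \<in> ?R k} = Suc d" if "x \<in> P" for x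
    using card_uncovered_colors[OF finP EP that _ prp ran m miss[OF that]] Suc.hyps(2) PK assms(3)
    by simp
  have codeg: "{x \<in> P. k \<in> {k. k < K \<and> x \<in> ?R k}} = ?R k" if "k < K" for k
    using that unfolding uncovered_def by auto
  obtain f where f: "inj_on f P" "\<And>x. x \<in> P \<Longrightarrow> f x < K \<and> x \<in> ?R (f x)"
    and tight: "\<And>k. k < K \<Longrightarrow> card (?R k) = Suc d \<Longrightarrow> k \<in> f ` P"
  proof -
    have "\<exists>f. inj_on f P \<and> (\<forall>x\<in>P. f x \<in> {k. k < K \<and> x \<in> ?R k}) \<and>
       (\<forall>k\<in>{..<K}. card {x \<in> P. k \<in> {k. k < K \<and> x \<in> ?R k}} = Suc d \<longrightarrow> k \<in> f ` P)"
    proof (rule matching_saturating_max_degree[OF finP])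
      fix k assume "k \<in> {..<K}"
      then show "card {x \<in> P. k \<in> {k. k < K \<and> x \<in> ?R k}} \<le> Suc d"
        using room[of k] codeg[of k] Suc.hyps(2) by simp
    qed (use deg in auto)
    then obtain f where f: "inj_on f P" "\<forall>x\<in>P. f x \<in> {k. k < K \<and> x \<in> ?R k}"
      "\<forall>k\<in>{..<K}. card {x \<in> P. k \<in> {k. k < K \<and> x \<in> ?R k}} = Suc d \<longrightarrow> k \<in> f ` P" by blast
    show ?thesis
    proof (rule that[OF f(1)])
      show "f x < K \<and> x \<in> ?R (f x)" if "x \<in> P" for x using f(2) that by blast
      show "k \<in> f ` P" if "k < K" "card (?R k) = Suc d" for k
        using f(3) that codeg[OF that(1)] by simp
    qed
  qed
  define c1 where "c1 e = (if y \<in> e then f (THE x. x \<in> e \<and> x \<noteq> y) else c e)" for e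
  let ?P = "insert y P"
  have c1y: "c1 {x, y} = f x" if "x \<in> P" for x
  proof -
    have "(THE z. z \<in> {x, y} \<and> z \<noteq> y) = x" using that y by (intro the_equality) auto
    then show ?thesis unfolding c1_def by simp
  qed
  have c1c: "c1 e = c e" if "e \<in> pairs P" for e
    using that y unfolding c1_def pairs_def by auto
  have split: "e \<in> pairs P - E \<or> (\<exists>x\<in>P. e = {x, y})" if "e \<in> pairs ?P - E" for e
  proof (cases "y \<in> e")
    case True
    moreover have "e \<in> pairs (insert y P)" using that by blast
    ultimately obtain x where "e = {y, x}" "x \<in> insert y P" "x \<noteq> y" using pairs_other_end by metis
    then show ?thesis by (auto simp: insert_commute)
  qed (use that in \<open>auto simp: pairs_def\<close>)
  have newE: "{x, y} \<in> pairs ?P - E" if "x \<in> P" for x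
    using that y EP unfolding pairs_def by (auto simp: card_2_iff)
  have fnew: "c e \<noteq> f x" if "e \<in> pairs P - E" "x \<in> e" "x \<in> P" for e x
    using f(2)[OF that(3)] that unfolding uncovered_def by auto
  have 1: "?P \<subseteq> V" using y PV by blast
  have 2: "E \<subseteq> pairs ?P" using EP pairs_mono[of P ?P] by blast
  have 3: "proper_on (pairs ?P - E) c1"
    unfolding proper_on_def
  proof (intro ballI impI)
    fix e g assume eg: "e \<in> pairs ?P - E" "g \<in> pairs ?P - E" "e \<noteq> g \<and> e \<inter> g \<noteq> {}"
    have yP: "y \<notin> e" if "e \<in> pairs P - E" for e using that y unfolding pairs_def by auto
    show "c1 e \<noteq> c1 g"
      using split[OF eg(1)] split[OF eg(2)]
    proof (elim disjE bexE)
      assume a: "e \<in> pairs P - E" "g \<in> pairs P - E"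
      then have "c e \<noteq> c g" using prp eg(3) unfolding proper_on_def by blast
      then show ?thesis using c1c a by auto
    next
      fix x assume a: "e \<in> pairs P - E" "x \<in> P" "g = {x, y}"
      then have "x \<in> e" using eg(3) yP by auto
      then show ?thesis using fnew[of e x] a c1y[of x] c1c[of e] by auto
    next
      fix x assume a: "x \<in> P" "e = {x, y}" "g \<in> pairs P - E"
      then have "x \<in> g" using eg(3) yP by auto
      then show ?thesis using fnew[of g x] a c1y[of x] c1c[of g] by auto
    next
      fix x z assume a: "x \<in> P" "e = {x, y}" "z \<in> P" "g = {z, y}"
      then have "x \<noteq> z" using eg(3) by auto
      then show ?thesis using a c1y f(1) by (simp add: inj_on_eq_iff)
    qed
  qed
  have 4: "c1 ` (pairs ?P - E) \<subseteq> {..<K}"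
    using split ran f(2) c1c c1y by fastforce
  have 5: "m k \<in> ?P" if "k < K" for k using mP[OF that] by blast
  have 6: "c1 e \<noteq> k" if "k < K" "e \<in> pairs ?P - E" "m k \<in> e" for k e
    using split[OF that(2)]
  proof (elim disjE bexE)
    assume "e \<in> pairs P - E"
    then show ?thesis using m[OF that(1) _ that(3)] c1c by auto
  next
    fix x assume x: "x \<in> P" "e = {x, y}"
    then have "m k = x" using that(1,3) mP[of k] y by auto
    moreover have "m (f x) \<noteq> x" using f(2)[OF x(1)] unfolding uncovered_def by auto
    ultimately show ?thesis using c1y[OF x(1)] x(2) by auto
  qed
  have 7: "card {k. k < K \<and> m k = x} = card {e \<in> E. x \<in> e}" if "x \<in> ?P" for x
  proof (cases "x = y")
    case True
    then have "{k. k < K \<and> m k = x} = {}" "{e \<in> E. x \<in> e} = {}"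
      using mP y EP unfolding pairs_def by auto
    then show ?thesis by (metis card.empty)
  qed (use that miss in auto)
  have 8: "card (uncovered E m ?P c1 k) \<le> card V - card ?P" if k: "k < K" for k
  proof (cases "k \<in> f ` P")
    case True
    then obtain x where x: "x \<in> P" "k = f x" by blast
    have "uncovered E m ?P c1 k \<subseteq> ?R k - {x}"
    proof
      fix z assume z: "z \<in> uncovered E m ?P c1 k"
      then have "z \<notin> {x, y}" using newE[OF x(1)] c1y[OF x(1)] x(2) unfolding uncovered_def by blast
      moreover have "z \<in> ?R k"
        using z calculation c1c pairs_mono[of P ?P] unfolding uncovered_def by fastforce
      ultimately show "z \<in> ?R k - {x}" by blast
    qed
    then have "card (uncovered E m ?P c1 k) \<le> card (?R k - {x})" using finR by (intro card_mono) auto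
    also have "\<dots> = card (?R k) - 1" using f(2)[OF x(1)] x(2) finR by simp
    also have "\<dots> \<le> d" using room[OF k] Suc.hyps(2) by simp
    finally show ?thesis using y finP Suc.hyps(2) by simp
  next
    case False
    have "uncovered E m ?P c1 k \<subseteq> insert y (?R k)"
      using c1c pairs_mono[of P ?P] unfolding uncovered_def by fastforce
    then have "card (uncovered E m ?P c1 k) \<le> card (insert y (?R k))" using finR by (intro card_mono) auto
    also have "\<dots> \<le> Suc (card (?R k))" by (simp add: card_insert_if finR)
    finally have le: "card (uncovered E m ?P c1 k) \<le> Suc (card (?R k))" .
    (* the size of an uncovered set has a fixed parity, so if it is not tight, it falls short by at least two *)
    have "card (?R k) \<noteq> Suc d" using tight[OF k] False by blast
    moreover have "card (?R k) \<le> Suc d" using room[OF k] Suc.hyps(2) by simp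
    moreover have "card (?R k) \<noteq> d"
    proof
      assume "card (?R k) = d"
      moreover have "even (card (?R k)) \<longleftrightarrow> odd (card P)"
        by (rule parity_uncovered) (use finP mP[OF k] prp m[OF k] in auto)
      moreover have "card V = card P + Suc d" using Suc.hyps(2) by linarith
      ultimately show False using assms(2) by auto
    qed
    ultimately have "Suc (card (?R k)) \<le> d" by linarith
    then show ?thesis using le y finP Suc.hyps(2) by simp
  qed
  have "d = card V - card ?P" using Suc.hyps(2) y finP by simp
  have "\<exists>c'. proper_on (pairs V - E) c' \<and> c' ` (pairs V - E) \<subseteq> {..<K} \<and>
     (\<forall>e\<in>pairs ?P - E. c' e = c1 e) \<and> (\<forall>k<K. \<forall>e\<in>pairs V - E. m k \<in> e \<longrightarrow> c' e \<noteq> k)"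
    by (rule Suc.hyps(1)[OF \<open>d = card V - card ?P\<close> 1 2 3 4]) (fact 5 6 7 8)+
  then obtain c' where c': "proper_on (pairs V - E) c'" "c' ` (pairs V - E) \<subseteq> {..<K}"
    "\<forall>e\<in>pairs ?P - E. c' e = c1 e" "\<forall>k<K. \<forall>e\<in>pairs V - E. m k \<in> e \<longrightarrow> c' e \<noteq> k"
    by blast
  have "\<forall>e\<in>pairs P - E. c' e = c e"
    using c'(3) c1c pairs_mono[of P ?P] by fastforce
  then show ?case using c'(1,2,4) by blast
qed

section \<open>Complete graphs of odd order with few edges removed\<close>

text \<open>
  The pairs of \<open>W\<close> make \<open>M\<close> a connected graph, and a connected set of edges grown from a single
  one gains at most one vertex with each edge.
\<close>
lemma connected_subset_few_vertices:
  assumes "finite M" "M \<subseteq> pairs V" "pairs W \<subseteq> M" "\<And>e. e \<in> M \<Longrightarrow> e \<inter> W \<noteq> {}"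
    and "1 \<le> h" "h \<le> card M"
  shows "\<exists>E\<subseteq>M. card E = h \<and> card (\<Union>E) \<le> h + 1"
  using assms(5,6)
proof (induction h rule: dec_induct)
  case base
  then obtain e where "e \<in> M" by (metis card.empty ex_in_conv not_one_le_zero)
  moreover then have "card e = 2" using assms(2) unfolding pairs_def by blast
  ultimately show ?case by (intro exI[of _ "{e}"]) auto
next
  case (step h)
  then obtain E where E: "E \<subseteq> M" "card E = h" "card (\<Union>E) \<le> h + 1" by auto
  have finE: "finite E" using E(1) assms(1) finite_subset by blast
  have finU: "finite (\<Union>E)"
  proof (rule finite_Union[OF finE])
    fix e assume "e \<in> E"
    then have "card e = 2" using E(1) assms(2) unfolding pairs_def by blast
    then show "finite e" by (simp add: card_ge_0_finite)
  qed
  obtain e where e: "e \<in> M - E" "e \<inter> \<Union>E \<noteq> {}"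
  proof -
    have "E \<noteq> M" using E(2) step.prems by auto
    then obtain e where e: "e \<in> M - E" using E(1) by blast
    have "E \<noteq> {}" using E(2) step.hyps by auto
    then obtain e0 where e0: "e0 \<in> E" by blast
    obtain w where w: "w \<in> e" "w \<in> W" using assms(4) e by blast
    obtain w0 where w0: "w0 \<in> e0" "w0 \<in> W" using assms(4) e0 E(1) by blast
    show ?thesis
    proof (cases "w \<in> \<Union>E")
      case True then show ?thesis using that e w by blast
    next
      case False
      then have "w \<noteq> w0" using w0 e0 by blast
      then have "{w, w0} \<in> M" using w w0 assms(3) by auto
      moreover have "{w, w0} \<notin> E" using False by blast
      ultimately show ?thesis using that[of "{w, w0}"] w0 e0 by blast
    qed
  qed
  have "card e = 2" using e(1) assms(2) unfolding pairs_def by blast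
  then have fine: "finite e" by (simp add: card_ge_0_finite)
  have "card (\<Union>(insert e E)) + card (e \<inter> \<Union>E) = card e + card (\<Union>E)"
    using card_Un_Int[OF fine finU] by simp
  moreover have "0 < card (e \<inter> \<Union>E)" using e(2) fine by (simp add: card_gt_0_iff)
  ultimately have "card (\<Union>(insert e E)) \<le> Suc h + 1" using \<open>card e = 2\<close> E(3) by linarith
  then show ?case using e(1) E finE by (intro exI[of _ "insert e E"]) auto
qed

lemma permutation_pulling_back_into:
  assumes "finite U" "B \<subseteq> U" "D \<subseteq> U" "card B \<le> card D"
  obtains \<pi> where "bij_betw \<pi> U U" "\<And>u. u \<in> U \<Longrightarrow> \<pi> u \<in> B \<Longrightarrow> u \<in> D"
proof -
  obtain D' where D': "D' \<subseteq> D" "card D' = card B"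
    using obtain_subset_with_card_n[OF assms(4)] by blast
  have fin: "finite B" "finite D'"
    using finite_subset[OF _ assms(1)] assms(2,3) D'(1) by auto
  obtain p where p: "bij_betw p D' B" using finite_same_card_bij[OF fin(2,1) D'(2)] by blast
  have "card (U - D') = card (U - B)"
    using assms D' fin by (simp add: card_Diff_subset)
  then obtain q where q: "bij_betw q (U - D') (U - B)"
    using finite_same_card_bij assms(1) by (metis finite_Diff)
  define \<pi> where "\<pi> u = (if u \<in> D' then p u else q u)" for u
  have "bij_betw \<pi> (D' \<union> (U - D')) (B \<union> (U - B))"
  proof (rule bij_betw_combine)
    show "bij_betw \<pi> D' B" using p by (subst bij_betw_cong[of _ _ p]) (auto simp: \<pi>_def)
    show "bij_betw \<pi> (U - D') (U - B)" using q by (subst bij_betw_cong[of _ _ q]) (auto simp: \<pi>_def)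
  qed auto
  moreover have "D' \<union> (U - D') = U" "B \<union> (U - B) = U" using D' assms by auto
  ultimately have "bij_betw \<pi> U U" by simp
  moreover have "u \<in> D" if "u \<in> U" "\<pi> u \<in> B" for u
    using that q D'(1) unfolding \<pi>_def bij_betw_def by (auto split: if_splits)
  ultimately show ?thesis using that by blast
qed

lemma proper_on_relabel:
  assumes "proper_on F c" "inj_on \<pi> V" "\<And>e. e \<in> F \<Longrightarrow> e \<subseteq> V \<and> \<pi> ` e \<in> F"
  shows "proper_on F (\<lambda>e. c (\<pi> ` e))"
  unfolding proper_on_def
proof (intro ballI impI)
  fix e f assume ef: "e \<in> F" "f \<in> F" "e \<noteq> f \<and> e \<inter> f \<noteq> {}"
  have "\<pi> ` e \<noteq> \<pi> ` f" using ef assms(2,3) by (metis inj_on_image_eq_iff)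
  moreover have "\<pi> ` e \<inter> \<pi> ` f \<noteq> {}" using ef by blast
  moreover have "\<pi> ` e \<in> F" "\<pi> ` f \<in> F" using assms(3) ef by auto
  ultimately show "c (\<pi> ` e) \<noteq> c (\<pi> ` f)" using assms(1) unfolding proper_on_def by simp
qed

text \<open>
  An edge \<open>e\<close> of the missing graph costs each of its ends \<open>x\<close> one color. Assigning that color to
  the incidence \<open>(x, e)\<close> keeps apart the missed colors of a vertex and makes them available
  later.
\<close>
definition incidences :: "'a set set \<Rightarrow> ('a \<times> 'a set) set" where
  "incidences E = {(x, e). e \<in> E \<and> x \<in> e}"

lemma finite_incidences:
  assumes "finite P" "E \<subseteq> pairs P"
  shows "finite (incidences E)"
proof (rule finite_subset)
  show "incidences E \<subseteq> P \<times> E" using assms(2) unfolding incidences_def pairs_def by auto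
  show "finite (P \<times> E)" using assms finite_pairs finite_subset by blast
qed

lemma card_incidences:
  assumes "finite P" "E \<subseteq> pairs P"
  shows "card (incidences E) = 2 * card E"
proof -
  have fin: "finite E" using assms finite_pairs finite_subset by blast
  have "incidences E = prod.swap ` (SIGMA e:E. e)"
    unfolding incidences_def by (force simp: image_iff)
  then have "card (incidences E) = card (SIGMA e:E. e)"
    by (metis card_image inj_swap)
  also have "\<dots> = (\<Sum>e\<in>E. card e)"
    using assms fin unfolding pairs_def by (intro card_SigmaI) (auto intro: finite_subset)
  also have "\<dots> = (\<Sum>e\<in>E. 2)"
    using assms(2) unfolding pairs_def by (intro sum.cong) auto
  finally show ?thesis by simp
qed

text \<open>
  At a vertex of \<open>P\<close>, the degree and the number of reserved colors add up to \<open>card P - 1 \<le> h\<close>,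
  so an edge has at most \<open>2 * h - 2\<close> obstacles and greedy coloring succeeds. The edges at \<open>j\<close>
  are colored before the others, so that they can also avoid the colors reserved at the
  neighbors \<open>F\<close> of \<open>j\<close> in \<open>E\<close>. Only edges from \<open>j\<close> to \<open>L\<close> may use those colors, and as many of
  them as possible do; the rest of these colors is left for edges to \<open>L - P\<close>.
\<close>
lemma color_few_vertices:
  fixes P F L :: "'a set"
  assumes "finite P" "E \<subseteq> pairs P" "card E = h" "card P \<le> h + 1" "1 \<le> h"
    and g: "bij_betw g (incidences E) {..<2 * h}"
    and F: "\<And>f. f \<in> F \<Longrightarrow> {f, j} \<in> E"
    and L: "j \<notin> L" "\<And>y. y \<in> L \<Longrightarrow> {j, y} \<notin> E"
  shows "\<exists>c. proper_on (pairs P - E) c \<and> c ` (pairs P - E) \<subseteq> {..<2 * h} \<and>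
    (\<forall>f\<in>pairs P - E. \<forall>x\<in>f. \<forall>e\<in>E. x \<in> e \<longrightarrow> c f \<noteq> g (x, e)) \<and>
    (\<forall>f\<in>F. \<forall>y\<in>P - L. j \<in> P \<and> y \<noteq> j \<and> {j, y} \<notin> E \<longrightarrow> c {j, y} \<noteq> g (f, {f, j})) \<and>
    (\<exists>L1\<subseteq>L \<inter> P. card L1 = min (card (L \<inter> P)) (card F) \<and>
        (\<lambda>y. c {j, y}) ` L1 \<subseteq> (\<lambda>f. g (f, {f, j})) ` F)"
proof -
  define C where "C = (\<lambda>f. g (f, {f, j})) ` F"
  define B where "B e = g ` {(x, e'). (x, e') \<in> incidences E \<and> x \<in> e}" for e
  define d where "d x = card {e \<in> E. x \<in> e}" for x
  have finE: "finite E" using assms(1,2) finite_pairs finite_subset by blast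
  have finI: "finite (incidences E)" by (rule finite_incidences[OF assms(1,2)])
  have injg: "inj_on g (incidences E)" using g by (rule bij_betw_imp_inj_on)
  have Fj: "f \<in> P \<and> j \<in> P \<and> f \<noteq> j" if "f \<in> F" for f
  proof -
    have "{f, j} \<in> pairs P" using F[OF that] assms(2) by blast
    then show ?thesis unfolding doubleton_in_pairs by blast
  qed
  have finF: "finite F" by (rule finite_subset[OF _ assms(1)]) (use Fj in blast)
  have FI: "(f, {f, j}) \<in> incidences E" if "f \<in> F" for f
    using F[OF that] unfolding incidences_def by auto
  have cardC: "card C = card F"
    unfolding C_def by (intro card_image inj_onI) (use FI injg in \<open>fastforce dest: inj_onD\<close>)
  have finB: "finite (B e)" for e
    unfolding B_def using finI by (intro finite_imageI) (auto intro: finite_subset)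
  have Bcard: "card (B {x, y}) \<le> d x + d y" for x y
  proof -
    have "B {x, y} \<subseteq> (\<lambda>e. g (x, e)) ` {e \<in> E. x \<in> e} \<union> (\<lambda>e. g (y, e)) ` {e \<in> E. y \<in> e}"
      unfolding B_def incidences_def by auto
    then have "card (B {x, y}) \<le> card ((\<lambda>e. g (x, e)) ` {e \<in> E. x \<in> e} \<union> (\<lambda>e. g (y, e)) ` {e \<in> E. y \<in> e})"
      using finE by (intro card_mono) auto
    also have "\<dots> \<le> card ((\<lambda>e. g (x, e)) ` {e \<in> E. x \<in> e}) + card ((\<lambda>e. g (y, e)) ` {e \<in> E. y \<in> e})"
      by (rule card_Un_le)
    also have "\<dots> \<le> d x + d y"
      unfolding d_def using finE by (intro add_mono card_image_le) auto
    finally show ?thesis .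
  qed
  have star: "card {e \<in> pairs P - E. x \<in> e} + d x = card P - 1" if "x \<in> P" for x
    unfolding d_def by (rule card_pairs_minus_at[OF assms(1) that assms(2)])

  (* the colors reserved by F are first spent on edges from j to L *)
  obtain L1 where L1: "L1 \<subseteq> L \<inter> P" "card L1 = min (card (L \<inter> P)) (card F)"
    by (metis min.cobounded1 obtain_subset_with_card_n)
  have "finite L1" using L1(1) assms(1) finite_subset by blast
  then obtain \<phi> where \<phi>: "\<phi> ` L1 \<subseteq> C" "inj_on \<phi> L1"
    using card_le_inj[of L1 C] L1(2) cardC finF unfolding C_def by auto
  define c0 where "c0 e = \<phi> (THE y. y \<in> e \<and> y \<noteq> j)" for e
  define E0 where "E0 = (\<lambda>y. {j, y}) ` L1"
  have c0: "c0 {j, y} = \<phi> y" if "y \<in> L1" for y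
  proof -
    have "(THE z. z \<in> {j, y} \<and> z \<noteq> j) = y" using that L1(1) L(1) by (intro the_equality) auto
    then show ?thesis unfolding c0_def by simp
  qed
  define S where "S = {e \<in> pairs P - E. j \<in> e}"
  have E0S: "E0 \<subseteq> S"
  proof
    fix e assume "e \<in> E0"
    then obtain y where y: "y \<in> L1" "e = {j, y}" unfolding E0_def by blast
    have "card L1 \<noteq> 0" using y \<open>finite L1\<close> by auto
    then have "F \<noteq> {}" using L1(2) by auto
    then show "e \<in> S" using y L1(1) L Fj unfolding S_def by auto
  qed
  have properE0: "proper_on E0 c0"
    unfolding proper_on_def
  proof (intro ballI impI)
    fix e f assume "e \<in> E0" "f \<in> E0" "e \<noteq> f \<and> e \<inter> f \<noteq> {}"
    then obtain y z where "y \<in> L1" "z \<in> L1" "e = {j, y}" "f = {j, z}" "y \<noteq> z"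
      unfolding E0_def by blast
    then show "c0 e \<noteq> c0 f" using c0 \<phi>(2) by (simp add: inj_on_eq_iff)
  qed
  have Crange: "C \<subseteq> {..<2 * h}" using FI g unfolding C_def bij_betw_def by blast
  have E0B: "c0 e \<notin> B e" if "e \<in> E0" for e
  proof
    assume "c0 e \<in> B e"
    obtain y where y: "y \<in> L1" "e = {j, y}" using \<open>e \<in> E0\<close> unfolding E0_def by blast
    have "c0 e \<in> C" using c0 y \<phi>(1) by auto
    then obtain f where f: "f \<in> F" "c0 e = g (f, {f, j})" unfolding C_def by blast
    obtain x e' where x: "(x, e') \<in> incidences E" "x \<in> e" "c0 e = g (x, e')"
      using \<open>c0 e \<in> B e\<close> unfolding B_def by auto
    have "x = f" using inj_onD[OF injg _ FI[OF f(1)] x(1)] f(2) x(3) by auto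
    moreover have "f \<noteq> j" using Fj f(1) by blast
    moreover have "{j, y} \<notin> E" using y(1) L1(1) L(2) by blast
    then have "f \<noteq> y" using F[OF f(1)] by (auto simp: insert_commute)
    ultimately show False using x(2) y(2) by auto
  qed
  have "\<exists>c. proper_on S c \<and> c ` S \<subseteq> {..<2 * h} \<and> (\<forall>e\<in>E0. c e = c0 e) \<and> (\<forall>e\<in>S - E0. c e \<notin> C \<union> B e)"
  proof (rule greedy_coloring[OF _ E0S properE0])
    show "finite S" unfolding S_def using finite_pairs[OF assms(1)] by simp
    show "c0 ` E0 \<subseteq> {..<2 * h}" using c0 \<phi>(1) Crange unfolding E0_def by auto
    show "finite (C \<union> B e)" for e using finB finF unfolding C_def by simp
    fix e assume "e \<in> S - E0"
    then have e: "e \<in> pairs P" "e \<notin> E" "j \<in> e" "e \<in> S" unfolding S_def by auto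
    then obtain q where q: "e = {j, q}" "q \<in> P" "q \<noteq> j" "j \<in> P" using pairs_other_end by metis
    have "card {f \<in> S. f \<noteq> e \<and> f \<inter> e \<noteq> {}} \<le> card (S - {e})"
      using finite_pairs[OF assms(1)] unfolding S_def by (intro card_mono) auto
    also have "\<dots> = card S - 1" using e(4) finite_pairs[OF assms(1)] unfolding S_def by simp
    finally have 1: "card {f \<in> S. f \<noteq> e \<and> f \<inter> e \<noteq> {}} \<le> card S - 1" .
    have 2: "card S + d j = card P - 1" unfolding S_def by (rule star[OF q(4)])
    have 3: "card (C \<union> B e) \<le> card F + (d j + d q)"
      using card_Un_le[of C "B e"] cardC Bcard[of j q, folded q(1)] by linarith
    (* an edge of E at q is none of the edges joining j to F *)
    have 4: "card F + d q \<le> h"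
    proof -
      have "inj_on (\<lambda>f. {f, j}) F" by (auto simp: inj_on_def doubleton_eq_iff)
      then have "card F + d q = card ((\<lambda>f. {f, j}) ` F) + card {e \<in> E. q \<in> e}"
        unfolding d_def by (simp add: card_image)
      also have "\<dots> = card ((\<lambda>f. {f, j}) ` F \<union> {e \<in> E. q \<in> e})"
      proof (rule card_Un_disjoint[symmetric])
        show "(\<lambda>f. {f, j}) ` F \<inter> {e \<in> E. q \<in> e} = {}"
          using e(2) q(1,3) F by (auto simp: insert_commute)
      qed (use finF finE in auto)
      also have "\<dots> \<le> card E" using F finE by (intro card_mono) auto
      finally show ?thesis using assms(3) by simp
    qed
    have "0 < card S" using e(4) finite_pairs[OF assms(1)] unfolding S_def card_gt_0_iff by auto
    then show "card {f \<in> S. f \<noteq> e \<and> f \<inter> e \<noteq> {}} + card (C \<union> B e) < 2 * h"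
      using 1 2 3 4 assms(4) by linarith
  qed
  then obtain cS where cS: "proper_on S cS" "cS ` S \<subseteq> {..<2 * h}" "\<forall>e\<in>E0. cS e = c0 e"
    "\<forall>e\<in>S - E0. cS e \<notin> C \<union> B e" by blast
  have "\<exists>c. proper_on (pairs P - E) c \<and> c ` (pairs P - E) \<subseteq> {..<2 * h} \<and> (\<forall>e\<in>S. c e = cS e) \<and>
      (\<forall>e\<in>pairs P - E - S. c e \<notin> B e)"
  proof (rule greedy_coloring[OF _ _ cS(1,2)])
    show "finite (pairs P - E)" using finite_pairs[OF assms(1)] by simp
    show "S \<subseteq> pairs P - E" unfolding S_def by blast
    show "finite (B e)" for e by (rule finB)
    fix e assume e: "e \<in> pairs P - E - S"
    then have "e \<in> pairs P" by blast
    then obtain x y where xy: "x \<in> P" "y \<in> P" "x \<noteq> y" "e = {x, y}" unfolding pairs_iff by blast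
    let ?X = "\<lambda>x. {e \<in> pairs P - E. x \<in> e}"
    have fin: "finite (?X x)" for x using finite_pairs[OF assms(1)] by simp
    have "card {f \<in> pairs P - E. f \<noteq> e \<and> f \<inter> e \<noteq> {}} \<le> card ((?X x - {e}) \<union> (?X y - {e}))"
      using fin xy(4) by (intro card_mono) auto
    also have "\<dots> \<le> card (?X x - {e}) + card (?X y - {e})" by (rule card_Un_le)
    also have "\<dots> = (card (?X x) - 1) + (card (?X y) - 1)" using e xy(4) by simp
    finally have 1: "card {f \<in> pairs P - E. f \<noteq> e \<and> f \<inter> e \<noteq> {}} \<le> (card (?X x) - 1) + (card (?X y) - 1)" .
    have "e \<in> ?X x" "e \<in> ?X y" using e xy(4) by auto
    then have "0 < card (?X x)" "0 < card (?X y)" using fin by (auto simp: card_gt_0_iff)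
    then show "card {f \<in> pairs P - E. f \<noteq> e \<and> f \<inter> e \<noteq> {}} + card (B e) < 2 * h"
      using 1 star[OF xy(1)] star[OF xy(2)] Bcard[of x y, folded xy(4)] assms(4,5) by linarith
  qed
  then obtain c where c: "proper_on (pairs P - E) c" "c ` (pairs P - E) \<subseteq> {..<2 * h}"
    "\<forall>e\<in>S. c e = cS e" "\<forall>e\<in>pairs P - E - S. c e \<notin> B e" by blast
  have "c f \<notin> B f" if "f \<in> pairs P - E" for f
    using that c(3,4) cS(3,4) E0B E0S by (metis DiffI UnI2 subsetD)
  then have "\<forall>f\<in>pairs P - E. \<forall>x\<in>f. \<forall>e\<in>E. x \<in> e \<longrightarrow> c f \<noteq> g (x, e)"
    unfolding B_def incidences_def by blast
  moreover have "c {j, y} \<noteq> g (f, {f, j})"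
    if "f \<in> F" "y \<in> P - L" "j \<in> P" "y \<noteq> j" "{j, y} \<notin> E" for f y
  proof -
    have "{j, y} \<in> S" using that unfolding S_def by auto
    moreover have "{j, y} \<notin> E0" using that L1(1) unfolding E0_def by (auto simp: doubleton_eq_iff)
    ultimately have "c {j, y} \<notin> C" using c(3) cS(4) by auto
    then show ?thesis using that(1) unfolding C_def by auto
  qed
  moreover have "(\<lambda>y. c {j, y}) ` L1 \<subseteq> C"
  proof
    fix k assume "k \<in> (\<lambda>y. c {j, y}) ` L1"
    then obtain y where y: "y \<in> L1" "k = c {j, y}" by blast
    then have "{j, y} \<in> E0" unfolding E0_def by blast
    then have "c {j, y} = \<phi> y" using c(3) cS(3) E0S c0[OF y(1)] by auto
    then show "k \<in> C" using y \<phi>(1) by blast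
  qed
  ultimately show ?thesis using c(1,2) L1 unfolding C_def by blast
qed

text \<open>
  A case of Plantholt's theorem on graphs with a spanning star: removing \<open>h\<close> edges from the
  complete graph on \<open>2 * h + 1\<close> vertices leaves a graph that \<open>2 * h\<close> colors suffice for, here
  when the removed edges cover at most \<open>h + 1\<close> vertices. Every color misses exactly one vertex,
  and \<open>g\<close> names the missed colors by incidences, which makes the colors \<open>g (x, e)\<close> usable for
  further edges at \<open>x\<close>. The last clause lets one vertex of the graph that is being folded be
  represented partly by such further edges at \<open>F\<close> and partly by edges at \<open>j\<close>: on the edges at
  \<open>j\<close> the colors concerned are confined to \<open>L\<close>.
\<close>
lemma color_sparse_complement_with_spare_colors:
  fixes V F L :: "'a set"
  assumes "finite V" "card V = 2 * h + 1" "E \<subseteq> pairs V" "card E = h" "card (\<Union>E) \<le> h + 1" "1 \<le> h"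
    and F: "\<And>f. f \<in> F \<Longrightarrow> {f, j} \<in> E"
    and L: "L \<subseteq> V" "j \<notin> L" "\<And>y. y \<in> L \<Longrightarrow> {j, y} \<notin> E" and FL: "card F \<le> card L"
  shows "\<exists>c g. proper_on (pairs V - E) c \<and> c ` (pairs V - E) \<subseteq> {..<2 * h} \<and>
    bij_betw g (incidences E) {..<2 * h} \<and>
    (\<forall>f\<in>pairs V - E. \<forall>x\<in>f. \<forall>e\<in>E. x \<in> e \<longrightarrow> c f \<noteq> g (x, e)) \<and>
    (\<forall>f\<in>F. \<forall>y\<in>V - L. y \<noteq> j \<and> {j, y} \<notin> E \<longrightarrow> c {j, y} \<noteq> g (f, {f, j}))"
proof -
  define P where "P = \<Union>E"
  have PV: "P \<subseteq> V" using assms(3) unfolding P_def pairs_def by blast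
  have finP: "finite P" using PV assms(1) finite_subset by blast
  have EP: "E \<subseteq> pairs P" using assms(3) unfolding P_def pairs_def by blast
  have cardP: "card P \<le> h + 1" using assms(5) unfolding P_def .
  have "finite (incidences E)" by (rule finite_incidences[OF finP EP])
  moreover have "card (incidences E) = 2 * h" using card_incidences[OF finP EP] assms(4) by simp
  ultimately obtain g where g: "bij_betw g (incidences E) {..<2 * h}"
    using ex_bij_betw_finite_nat by (metis atLeast0LessThan)
  define C where "C = (\<lambda>f. g (f, {f, j})) ` F"
  obtain c L1 where c: "proper_on (pairs P - E) c" "c ` (pairs P - E) \<subseteq> {..<2 * h}"
    "\<forall>f\<in>pairs P - E. \<forall>x\<in>f. \<forall>e\<in>E. x \<in> e \<longrightarrow> c f \<noteq> g (x, e)"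
    "\<forall>f\<in>F. \<forall>y\<in>P - L. j \<in> P \<and> y \<noteq> j \<and> {j, y} \<notin> E \<longrightarrow> c {j, y} \<noteq> g (f, {f, j})"
    and L1: "L1 \<subseteq> L \<inter> P" "card L1 = min (card (L \<inter> P)) (card F)" "(\<lambda>y. c {j, y}) ` L1 \<subseteq> C"
    using color_few_vertices[OF finP EP assms(4) cardP assms(6) g F L(2,3), of F] unfolding C_def by auto
  (* the end for which the color k is reserved *)
  define m where "m k = fst (inv_into (incidences E) g k)" for k
  have inv: "inv_into (incidences E) g k \<in> incidences E" if "k < 2 * h" for k
    using g that by (metis bij_betw_def inv_into_into lessThan_iff)
  have mg: "m (g (x, e)) = x" "g (x, e) < 2 * h" if "e \<in> E" "x \<in> e" for x e
  proof -
    have "(x, e) \<in> incidences E" using that unfolding incidences_def by auto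
    then show "m (g (x, e)) = x" "g (x, e) < 2 * h"
      using g unfolding m_def bij_betw_def by auto
  qed
  have gm: "\<exists>e\<in>E. m k \<in> e \<and> k = g (m k, e)" if "k < 2 * h" for k
  proof -
    obtain x e where xe: "inv_into (incidences E) g k = (x, e)" by fastforce
    moreover have "g (inv_into (incidences E) g k) = k"
      using g that by (metis bij_betw_inv_into_right lessThan_iff)
    ultimately show ?thesis using inv[OF that] unfolding m_def incidences_def by auto
  qed
  have "\<exists>c'. proper_on (pairs V - E) c' \<and> c' ` (pairs V - E) \<subseteq> {..<2 * h} \<and>
     (\<forall>e\<in>pairs P - E. c' e = c e) \<and> (\<forall>k<2 * h. \<forall>e\<in>pairs V - E. m k \<in> e \<longrightarrow> c' e \<noteq> k)"
  proof (rule extend_by_universal_vertices[OF assms(1) _ _ PV EP c(1,2)])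
    show "odd (card V)" "2 * h = card V - 1" using assms(2) by auto
    show "m k \<in> P" if "k < 2 * h" for k using gm[OF that] unfolding P_def by blast
    show "c e \<noteq> k" if "k < 2 * h" "e \<in> pairs P - E" "m k \<in> e" for k e
      using gm[OF that(1)] c(3) that by metis
    show "card {k. k < 2 * h \<and> m k = x} = card {e \<in> E. x \<in> e}" if "x \<in> P" for x
    proof -
      have "{k. k < 2 * h \<and> m k = x} = (\<lambda>e. g (x, e)) ` {e \<in> E. x \<in> e}"
        using gm mg by (fastforce simp: image_iff)
      moreover have "inj_on (\<lambda>e. g (x, e)) {e \<in> E. x \<in> e}"
        using g unfolding bij_betw_def inj_on_def incidences_def by auto
      ultimately show ?thesis by (simp add: card_image)
    qed
    show "card (uncovered E m P c k) \<le> card V - card P" if "k < 2 * h" for k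
    proof -
      have "m k \<in> P" using gm[OF that] unfolding P_def by blast
      moreover have "uncovered E m P c k \<subseteq> P - {m k}" unfolding uncovered_def by blast
      then have "card (uncovered E m P c k) \<le> card (P - {m k})" using finP by (intro card_mono) auto
      ultimately show ?thesis using finP assms(2) cardP by simp
    qed
  qed
  then obtain c' where c': "proper_on (pairs V - E) c'" "c' ` (pairs V - E) \<subseteq> {..<2 * h}"
    "\<forall>e\<in>pairs P - E. c' e = c e" "\<forall>k<2 * h. \<forall>e\<in>pairs V - E. m k \<in> e \<longrightarrow> c' e \<noteq> k" by blast

  (* all vertices outside P are twins, so those that j reaches with a reserved color may be taken in L *)
  define B where "B = {w \<in> V - P. c' {j, w} \<in> C}"
  have jP: "j \<in> P" if "F \<noteq> {}" using that F unfolding P_def by blast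
  have finF: "finite F" using F EP finP by (metis (no_types, lifting) doubleton_in_pairs finite_subset subsetD subsetI)
  have "card B \<le> card (L - P)"
  proof (cases "F = {}")
    case True
    then show ?thesis unfolding B_def C_def by simp
  next
    case False
    note jP = jP[OF False]
    have sub: "L1 \<subseteq> L" "L1 \<subseteq> P" "L1 \<subseteq> V" "B \<subseteq> V" using L1(1) L(1) unfolding B_def by auto
    have edge: "{j, w} \<in> pairs V - E" if "w \<in> L1 \<union> B" for w
      using that sub jP PV L EP unfolding B_def by auto
    have c1: "c' {j, w} = c {j, w}" if "w \<in> L1" for w
      using c'(3) edge[of w] that sub jP by auto
    have "inj_on (\<lambda>w. c' {j, w}) (L1 \<union> B)"
    proof (rule inj_onI)
      fix w z assume wz: "w \<in> L1 \<union> B" "z \<in> L1 \<union> B" "c' {j, w} = c' {j, z}"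
      have "{j, w} = {j, z}"
        by (rule proper_onD[OF c'(1) edge[OF wz(1)] edge[OF wz(2)] wz(3), of j]) auto
      then show "w = z" by (auto simp: doubleton_eq_iff)
    qed
    moreover have "(\<lambda>w. c' {j, w}) ` (L1 \<union> B) \<subseteq> C" using L1(3) c1 unfolding B_def by auto
    moreover have "finite C" unfolding C_def using finF by simp
    ultimately have "card (L1 \<union> B) \<le> card C" by (metis card_inj_on_le)
    also have "\<dots> \<le> card F" unfolding C_def by (rule card_image_le[OF finF])
    finally have "card (L1 \<union> B) \<le> card F" .
    moreover have "finite L1" "finite B" using sub assms(1) finite_subset by blast+
    then have "card (L1 \<union> B) = card L1 + card B"
      using sub unfolding B_def by (intro card_Un_disjoint) auto
    moreover have "card L = card (L \<inter> P) + card (L - P)"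
      using card_Int_Diff[of L P] finite_subset[OF L(1) assms(1)] by simp
    ultimately show ?thesis using L1(2) FL by linarith
  qed
  then obtain \<pi>0 where \<pi>0: "bij_betw \<pi>0 (V - P) (V - P)" "\<And>u. u \<in> V - P \<Longrightarrow> \<pi>0 u \<in> B \<Longrightarrow> u \<in> L - P"
    using permutation_pulling_back_into[of "V - P" B "L - P"] assms(1) L(1) unfolding B_def by blast
  define \<pi> where "\<pi> x = (if x \<in> P then x else \<pi>0 x)" for x
  have "bij_betw \<pi> (P \<union> (V - P)) (P \<union> (V - P))"
  proof (rule bij_betw_combine)
    show "bij_betw \<pi> P P" by (subst bij_betw_cong[of _ _ id]) (auto simp: \<pi>_def)
    show "bij_betw \<pi> (V - P) (V - P)" using \<pi>0(1) by (subst bij_betw_cong[of _ _ \<pi>0]) (auto simp: \<pi>_def)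
  qed auto
  then have \<pi>: "bij_betw \<pi> V V" using PV by (simp add: Un_absorb1)
  have \<pi>P: "\<pi> x \<in> P \<longleftrightarrow> x \<in> P" if "x \<in> V" for x
    using that \<pi>0(1) unfolding \<pi>_def bij_betw_def by auto
  have \<pi>E: "\<pi> ` e \<in> pairs V - E" if e: "e \<in> pairs V - E" for e
  proof -
    have eV: "e \<subseteq> V" "card e = 2" using e unfolding pairs_def by auto
    have "card (\<pi> ` e) = 2" using \<pi> eV by (metis bij_betw_imp_inj_on card_image inj_on_subset)
    moreover have "\<pi> ` e \<subseteq> V" using \<pi> eV unfolding bij_betw_def by blast
    moreover have "\<pi> ` e \<notin> E"
    proof
      assume a: "\<pi> ` e \<in> E"
      then have "\<pi> ` e \<subseteq> P" unfolding P_def by blast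
      then have "e \<subseteq> P" using \<pi>P eV(1) by blast
      then have "\<pi> ` e = e" unfolding \<pi>_def by (auto simp: subset_iff)
      then show False using a e by simp
    qed
    ultimately show ?thesis unfolding pairs_def by blast
  qed
  define c2 where "c2 = (\<lambda>e. c' (\<pi> ` e))"
  have "proper_on (pairs V - E) c2"
    unfolding c2_def
  proof (rule proper_on_relabel[OF c'(1) bij_betw_imp_inj_on[OF \<pi>]])
    show "e \<subseteq> V \<and> \<pi> ` e \<in> pairs V - E" if "e \<in> pairs V - E" for e
      using \<pi>E[OF that] that unfolding pairs_def by blast
  qed
  moreover have "c2 ` (pairs V - E) \<subseteq> {..<2 * h}" unfolding c2_def using \<pi>E c'(2) by blast
  moreover have "c2 f \<noteq> g (x, e)" if "f \<in> pairs V - E" "x \<in> f" "e \<in> E" "x \<in> e" for f x e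
  proof -
    have "x \<in> P" using that unfolding P_def by blast
    then have "\<pi> x = x" unfolding \<pi>_def by simp
    then have "m (g (x, e)) \<in> \<pi> ` f" using mg(1)[OF that(3,4)] that(2) by force
    then show ?thesis using c'(4) mg(2)[OF that(3,4)] \<pi>E[OF that(1)] unfolding c2_def by blast
  qed
  moreover have "c2 {j, y} \<noteq> g (f, {f, j})" if "f \<in> F" "y \<in> V - L" "y \<noteq> j" "{j, y} \<notin> E" for f y
  proof (cases "y \<in> P")
    case True
    have jP': "j \<in> P" using jP that(1) by blast
    have "\<pi> ` {j, y} = {j, y}" using True jP' unfolding \<pi>_def by simp
    moreover have "{j, y} \<in> pairs P - E" using True jP' that by auto
    ultimately have "c2 {j, y} = c {j, y}" using c'(3) unfolding c2_def by simp
    then show ?thesis using c(4) that True jP' by auto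
  next
    case False
    have jP': "j \<in> P" using jP that(1) by blast
    have "\<pi> y \<in> V - P" using \<pi>P[of y] \<pi> that False unfolding bij_betw_def by blast
    moreover have "\<pi>0 y \<notin> B" using \<pi>0(2)[of y] that False by blast
    ultimately have "c' {j, \<pi> y} \<notin> C" using False unfolding B_def \<pi>_def by auto
    moreover have "\<pi> ` {j, y} = {j, \<pi> y}" using jP' unfolding \<pi>_def by simp
    ultimately show ?thesis using that(1) unfolding c2_def C_def by auto
  qed
  ultimately show ?thesis
    using g by (intro exI[of _ c2] exI[of _ g] conjI ballI impI) (assumption | elim conjE | simp)+
qed

section \<open>Complete graphs with an odd number of colors\<close>

text \<open>
  With \<open>K\<close> odd, the color \<open>i + j\<close> modulo \<open>K\<close> on \<open>{0..<K}\<close> leaves the color \<open>2 * i\<close> free at \<open>i\<close>;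
  these free colors are distinct and serve the edges of one more vertex, which carries the label
  \<open>K\<close>.
\<close>
lemma odd_coloring_complete_graph:
  assumes "finite V" "card V \<le> K + 1" "odd K"
  shows "\<exists>c. proper_on (pairs V) c \<and> c ` pairs V \<subseteq> {..<K}"
proof -
  obtain \<phi> where \<phi>: "\<phi> ` V \<subseteq> {..K}" "inj_on \<phi> V"
    using card_le_inj[OF assms(1), of "{..K}"] assms(2) by auto
  (* an edge from i to the vertex labeled K gets 2 * (i + K), which is 2 * i modulo K *)
  define c where "c e = ((if K \<in> \<phi> ` e then 2 else 1) * (\<Sum>x\<in>e. \<phi> x)) mod K" for e
  have K: "0 < K" using assms(3) by (rule odd_pos)
  have cancel: "b = d"
    if "b < K" "d < K" "u = 1 \<or> u = 2" "(a + u * b) mod K = (a + u * d) mod K" for a b d u :: nat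
  proof -
    have "int (a + u * b) mod int K = int (a + u * d) mod int K" using that(4) by (metis of_nat_mod)
    then have "int K dvd int (a + u * b) - int (a + u * d)" by (simp only: mod_eq_dvd_iff)
    then have "int K dvd int u * (int b - int d)" by (simp add: algebra_simps)
    moreover have "coprime (int K) (int u)" using that(3) assms(3) by auto
    ultimately have "int K dvd int b - int d" by (simp add: coprime_dvd_mult_right_iff)
    then have "\<bar>int K\<bar> \<le> \<bar>int b - int d\<bar>" if "int b - int d \<noteq> 0" using that dvd_imp_le_int by blast
    then show ?thesis using that(1,2) by linarith
  qed
  have neq: "c {x, y} \<noteq> c {x, z}" if "x \<in> V" "y \<in> V" "z \<in> V" "x \<noteq> y" "x \<noteq> z" "y \<noteq> z" for x y z
  proof
    assume eq: "c {x, y} = c {x, z}"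
    have le: "\<phi> x \<le> K" "\<phi> y \<le> K" "\<phi> z \<le> K" and ne: "\<phi> x \<noteq> \<phi> y" "\<phi> x \<noteq> \<phi> z" "\<phi> y \<noteq> \<phi> z"
      using that \<phi> by (auto simp: inj_on_eq_iff)
    have val: "c {u, v} = ((if \<phi> u = K \<or> \<phi> v = K then 2 else 1) * (\<phi> u + \<phi> v)) mod K" if "u \<noteq> v" for u v
      using that unfolding c_def by auto
    have fold: "(2 * (a + K)) mod K = (a + 1 * a) mod K" for a
    proof -
      have "2 * (a + K) = (a + 1 * a) + K * 2" by simp
      then show ?thesis by (simp only: mod_mult_self2)
    qed
    consider "\<phi> x = K" | "\<phi> y = K" | "\<phi> z = K" | "\<phi> x < K" "\<phi> y < K" "\<phi> z < K" using le by linarith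
    then show False
    proof cases
      case 1
      then have "(2 * K + 2 * \<phi> y) mod K = (2 * K + 2 * \<phi> z) mod K"
        using eq val[of x y] val[of x z] that by (simp add: algebra_simps)
      then show False using cancel[of "\<phi> y" "\<phi> z" 2 "2 * K"] 1 le ne by auto
    next
      case 2
      then have "(\<phi> x + 1 * \<phi> x) mod K = (\<phi> x + 1 * \<phi> z) mod K"
        using eq val[of x y] val[of x z] that ne fold[of "\<phi> x"] by simp
      then show False using cancel[of "\<phi> x" "\<phi> z" 1 "\<phi> x"] 2 le ne by auto
    next
      case 3
      then have "(\<phi> x + 1 * \<phi> y) mod K = (\<phi> x + 1 * \<phi> x) mod K"
        using eq val[of x y] val[of x z] that ne fold[of "\<phi> x"] by simp
      then show False using cancel[of "\<phi> y" "\<phi> x" 1 "\<phi> x"] 3 le ne by auto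
    next
      case 4
      then have "(\<phi> x + 1 * \<phi> y) mod K = (\<phi> x + 1 * \<phi> z) mod K"
        using eq val[of x y] val[of x z] that by simp
      then show False using cancel[of "\<phi> y" "\<phi> z" 1 "\<phi> x"] 4 ne by auto
    qed
  qed
  have "proper_on (pairs V) c"
    unfolding proper_on_def
  proof (intro ballI impI)
    fix e f assume ef: "e \<in> pairs V" "f \<in> pairs V" "e \<noteq> f \<and> e \<inter> f \<noteq> {}"
    then obtain x where "x \<in> e" "x \<in> f" by blast
    then obtain y z where "e = {x, y}" "y \<in> V" "y \<noteq> x" "x \<in> V" "f = {x, z}" "z \<in> V" "z \<noteq> x"
      using pairs_other_end[OF ef(1)] pairs_other_end[OF ef(2)] by metis
    then show "c e \<noteq> c f" using neq[of x y z] ef(3) by auto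
  qed
  moreover have "c ` pairs V \<subseteq> {..<K}" unfolding c_def using K by auto
  ultimately show ?thesis by blast
qed

section \<open>Folding the stable set\<close>

text \<open>
  What a transitive orientation leaves of the structure of \<open>G\<close>: outside \<open>Q\<close>, vertices of \<open>A\<close> are
  adjacent only to \<open>SA\<close>, vertices of \<open>B\<close> only to \<open>SB\<close>, and all others to nothing. The sets \<open>SA\<close>
  and \<open>SB\<close> may overlap.
\<close>
locale two_sided_split =
  fixes G :: "'a graph" and Q A B SA SB :: "'a set"
  assumes fin: "finite Q" "finite SA" "finite SB"
    and AB: "A \<subseteq> Q" "B \<subseteq> Q" "A \<inter> B = {}"
    and QS: "Q \<inter> (SA \<union> SB) = {}"
    and edge_cases: "\<And>e. e \<in> edges G \<Longrightarrow>
      e \<in> pairs Q \<or> (\<exists>q\<in>A. \<exists>s\<in>SA. e = {q, s}) \<or> (\<exists>q\<in>B. \<exists>s\<in>SB. e = {q, s})"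
begin

lemma not_in_S: "q \<in> Q \<Longrightarrow> q \<notin> SA \<and> q \<notin> SB"
  using QS by blast

lemma neighbor_cases:
  assumes "{q, y} \<in> edges G" "q \<in> Q"
  shows "y \<noteq> q \<and> (y \<in> Q \<or> q \<in> A \<and> y \<in> SA \<or> q \<in> B \<and> y \<in> SB)"
  using edge_cases[OF assms(1)]
proof (elim disjE bexE)
  assume "{q, y} \<in> pairs Q"
  then show ?thesis by auto
next
  fix a s assume "a \<in> A" "s \<in> SA" "{q, y} = {a, s}"
  then show ?thesis using assms(2) AB(1) not_in_S by (auto simp: doubleton_eq_iff)
next
  fix b s assume "b \<in> B" "s \<in> SB" "{q, y} = {b, s}"
  then show ?thesis using assms(2) AB(2) not_in_S by (auto simp: doubleton_eq_iff)
qed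

lemma edge_end_in_Q:
  assumes "e \<in> edges G" "x \<in> e" "x \<notin> Q"
  obtains q where "q \<in> Q" "e = {q, x}" "x \<in> SA \<union> SB"
  using edge_cases[OF assms(1)]
proof (elim disjE bexE)
  assume "e \<in> pairs Q"
  then show ?thesis using assms(2,3) unfolding pairs_def by blast
next
  fix a s assume "a \<in> A" "s \<in> SA" "e = {a, s}"
  then show ?thesis using assms(2,3) AB(1) that[of a] by blast
next
  fix b s assume "b \<in> B" "s \<in> SB" "e = {b, s}"
  then show ?thesis using assms(2,3) AB(2) that[of b] by blast
qed

lemma edge_has_end_in_Q:
  assumes "e \<in> edges G"
  obtains q y where "q \<in> Q" "e = {q, y}" "q \<noteq> y"
  using edge_cases[OF assms]
proof (elim disjE bexE)
  assume "e \<in> pairs Q"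
  then show ?thesis using that unfolding pairs_iff by blast
next
  fix a s assume "a \<in> A" "s \<in> SA" "e = {a, s}"
  then show ?thesis using AB(1) not_in_S[of a] that[of a s] by auto
next
  fix b s assume "b \<in> B" "s \<in> SB" "e = {b, s}"
  then show ?thesis using AB(2) not_in_S[of b] that[of b s] by auto
qed

definition fold_into :: "('a \<Rightarrow> 'a) \<Rightarrow> 'a \<Rightarrow> 'a" where
  "fold_into \<sigma> x = (if x \<in> SB - SA then \<sigma> x else x)"

lemma fold_into_Q: "q \<in> Q \<Longrightarrow> fold_into \<sigma> q = q"
  using not_in_S unfolding fold_into_def by simp

lemma fold_into_neighbor:
  assumes "\<sigma> ` (SB - SA) \<subseteq> SA - SB" "{q, y} \<in> edges G" "q \<in> Q"
  shows "{q, fold_into \<sigma> y} \<in> pairs (Q \<union> SA)"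
proof (cases "y \<in> SB - SA")
  case True
  then have "\<sigma> y \<in> SA" using assms(1) by blast
  then show ?thesis using assms(3) not_in_S[OF assms(3)] True unfolding fold_into_def by auto
next
  case False
  then show ?thesis using neighbor_cases[OF assms(2,3)] assms(3) unfolding fold_into_def by auto
qed

text \<open>
  A vertex of \<open>SB - SA\<close> and its image in \<open>SA - SB\<close> have their neighbors in \<open>B\<close> and in \<open>A\<close>
  respectively, so no vertex of \<open>Q\<close> sees both.
\<close>
lemma fold_into_inj_neighbors:
  assumes "inj_on \<sigma> (SB - SA)" "\<sigma> ` (SB - SA) \<subseteq> SA - SB" "q \<in> Q"
    and "{q, y} \<in> edges G" "{q, z} \<in> edges G" "fold_into \<sigma> y = fold_into \<sigma> z"
  shows "y = z"
proof -
  have in_SB: "x \<in> SB" if "{q, x} \<in> edges G" "{q, s} \<in> edges G" "s \<in> SB - SA" "x \<in> SA" for x s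
    using neighbor_cases[OF that(1) assms(3)] neighbor_cases[OF that(2) assms(3)] that(3,4) AB(3) not_in_S by blast
  have ne: "x \<noteq> \<sigma> s" if "{q, x} \<in> edges G" "{q, s} \<in> edges G" "s \<in> SB - SA" "x \<notin> SB - SA" for x s
  proof
    assume "x = \<sigma> s"
    then have "x \<in> SA" "x \<notin> SB" using assms(2) that(3) by blast+
    then show False using in_SB that by blast
  qed
  show ?thesis
    using assms(4-6) ne[of y z] ne[of z y] inj_onD[OF assms(1), of y z]
    unfolding fold_into_def by (auto split: if_splits)
qed

text \<open>
  An edge takes the color of its image under the folding or, if the image is one of the removed
  edges \<open>E\<close>, the color reserved for its end in \<open>Q\<close>. Reserved colors are pairwise distinct, so
  the only danger is a vertex of \<open>SB - SA\<close> some of whose edges keep their image while others do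
  not; the hypothesis \<open>partial\<close> is about these.
\<close>
lemma pull_back_coloring:
  assumes \<sigma>: "inj_on \<sigma> (SB - SA)" "\<sigma> ` (SB - SA) \<subseteq> SA - SB"
    and E: "E \<inter> edges G = {}"
    and c: "proper_on (pairs (Q \<union> SA) - E) c" "c ` (pairs (Q \<union> SA) - E) \<subseteq> {..<K}"
    and g: "inj_on g (incidences E)" "g ` incidences E \<subseteq> {..<K}"
    and spare: "\<And>f x e. f \<in> pairs (Q \<union> SA) - E \<Longrightarrow> x \<in> f \<Longrightarrow> e \<in> E \<Longrightarrow> x \<in> e \<Longrightarrow> c f \<noteq> g (x, e)"
    and partial: "\<And>q q' s. s \<in> SB - SA \<Longrightarrow> {q, s} \<in> edges G \<Longrightarrow> {q', s} \<in> edges G \<Longrightarrow> q \<in> Q \<Longrightarrow> q' \<in> Q \<Longrightarrow>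
      {q, \<sigma> s} \<in> E \<Longrightarrow> {q', \<sigma> s} \<notin> E \<Longrightarrow> c {q', \<sigma> s} \<noteq> g (q, {q, \<sigma> s})"
  shows "\<exists>c'. edge_coloring G K c'"
proof -
  let ?f = "fold_into \<sigma>"
  define c' where "c' e = (if ?f ` e \<in> E then g (THE q. q \<in> e \<and> q \<in> Q, ?f ` e) else c (?f ` e))" for e
  have img: "?f ` {q, y} = {q, ?f y}" if "q \<in> Q" for q y using fold_into_Q[OF that] by simp
  have outside: "y \<in> SB - SA" if "{q, y} \<in> edges G" "{q, ?f y} \<in> E" for q y
    using that E unfolding fold_into_def by (auto split: if_splits)
  have val: "c' {q, y} = (if {q, ?f y} \<in> E then g (q, {q, ?f y}) else c {q, ?f y})"
    if "{q, y} \<in> edges G" "q \<in> Q" for q y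
  proof (cases "{q, ?f y} \<in> E")
    case True
    then have "y \<notin> Q" using outside[OF that(1)] not_in_S by blast
    then have "(THE x. x \<in> {q, y} \<and> x \<in> Q) = q" using that(2) by (intro the_equality) auto
    then show ?thesis using True img[OF that(2)] unfolding c'_def by simp
  qed (use img[OF that(2)] in \<open>simp add: c'_def\<close>)
  have pr: "{q, ?f y} \<in> pairs (Q \<union> SA)" if "{q, y} \<in> edges G" "q \<in> Q" for q y
    by (rule fold_into_neighbor[OF \<sigma>(2) that])
  have inc: "(q, {q, ?f y}) \<in> incidences E" if "{q, ?f y} \<in> E" for q y
    using that unfolding incidences_def by auto
  have "c' ` edges G \<subseteq> {..<K}"
  proof
    fix k assume "k \<in> c' ` edges G"
    then obtain e where e: "e \<in> edges G" "k = c' e" by blast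
    obtain q y where qy: "q \<in> Q" "e = {q, y}" "q \<noteq> y" by (rule edge_has_end_in_Q[OF e(1)])
    then have qyE: "{q, y} \<in> edges G" using e(1) by simp
    show "k \<in> {..<K}"
    proof (cases "{q, ?f y} \<in> E")
      case True
      then have "k = g (q, {q, ?f y})" using val[OF qyE qy(1)] e(2) qy(2) by simp
      then show ?thesis using inc[OF True] g(2) by blast
    next
      case False
      then have "k = c {q, ?f y}" using val[OF qyE qy(1)] e(2) qy(2) by simp
      then show ?thesis using pr[OF qyE qy(1)] False c(2) by blast
    qed
  qed
  moreover have "c' e \<noteq> c' f" if ef: "e \<in> edges G" "f \<in> edges G" "e \<noteq> f" "x \<in> e" "x \<in> f" for e f x
  proof (cases "x \<in> Q")
    case True
    have other: "\<exists>y. e = {x, y}" if eG: "e \<in> edges G" and xe: "x \<in> e" for e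
    proof -
      obtain a y where ay: "a \<in> Q" "e = {a, y}" "a \<noteq> y" by (rule edge_has_end_in_Q[OF eG])
      then have "e = {x, y} \<or> e = {x, a}" using xe by auto
      then show ?thesis by blast
    qed
    obtain y z where yz: "e = {x, y}" "f = {x, z}" using other[OF ef(1,4)] other[OF ef(2,5)] by blast
    have "?f y \<noteq> ?f z" using fold_into_inj_neighbors[OF \<sigma> True] ef yz by auto
    then have ne: "{x, ?f y} \<noteq> {x, ?f z}" by (auto simp: doubleton_eq_iff)
    have e': "{x, y} \<in> edges G" "{x, z} \<in> edges G" using ef yz by auto
    note p = pr[OF e'(1) True] pr[OF e'(2) True]
    note v = val[OF e'(1) True] val[OF e'(2) True]
    show ?thesis
    proof (cases "{x, ?f y} \<in> E"; cases "{x, ?f z} \<in> E")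
      assume "{x, ?f y} \<in> E" "{x, ?f z} \<in> E"
      then show ?thesis using v yz ne inj_onD[OF g(1) _ inc inc, of x y x z] by auto
    next
      assume a: "{x, ?f y} \<in> E" "{x, ?f z} \<notin> E"
      then have "c {x, ?f z} \<noteq> g (x, {x, ?f y})" using p by (intro spare) auto
      then show ?thesis using v yz a by auto
    next
      assume a: "{x, ?f y} \<notin> E" "{x, ?f z} \<in> E"
      then have "c {x, ?f y} \<noteq> g (x, {x, ?f z})" using p by (intro spare) auto
      then show ?thesis using v yz a by auto
    next
      assume a: "{x, ?f y} \<notin> E" "{x, ?f z} \<notin> E"
      then have "c {x, ?f y} \<noteq> c {x, ?f z}"
        using p ne proper_onD[OF c(1), of "{x, ?f y}" "{x, ?f z}" x] by auto
      then show ?thesis using v yz a by auto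
    qed
  next
    case False
    obtain q where q: "q \<in> Q" "e = {q, x}" "x \<in> SA \<union> SB" by (rule edge_end_in_Q[OF ef(1,4) False])
    obtain q' where q': "q' \<in> Q" "f = {q', x}" "x \<in> SA \<union> SB" by (rule edge_end_in_Q[OF ef(2,5) False])
    have e': "{q, x} \<in> edges G" "{q', x} \<in> edges G" "q \<noteq> q'" using ef q q' by auto
    note p = pr[OF e'(1) q(1)] pr[OF e'(2) q'(1)]
    note v = val[OF e'(1) q(1)] val[OF e'(2) q'(1)]
    have ne: "{q, ?f x} \<noteq> {q', ?f x}" using e'(3) by (auto simp: doubleton_eq_iff)
    show ?thesis
    proof (cases "{q, ?f x} \<in> E"; cases "{q', ?f x} \<in> E")
      assume "{q, ?f x} \<in> E" "{q', ?f x} \<in> E"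
      then show ?thesis using v q q' ne inj_onD[OF g(1) _ inc inc, of q x q' x] e'(3) by auto
    next
      assume a: "{q, ?f x} \<in> E" "{q', ?f x} \<notin> E"
      then have x: "x \<in> SB - SA" using outside e' by blast
      then have fx: "?f x = \<sigma> x" unfolding fold_into_def by simp
      have "c {q', ?f x} \<noteq> g (q, {q, ?f x})"
        using partial[OF x e'(1,2) q(1) q'(1)] a unfolding fx by blast
      then show ?thesis using v q q' a by auto
    next
      assume a: "{q, ?f x} \<notin> E" "{q', ?f x} \<in> E"
      then have x: "x \<in> SB - SA" using outside e' by blast
      then have fx: "?f x = \<sigma> x" unfolding fold_into_def by simp
      have "c {q, ?f x} \<noteq> g (q', {q', ?f x})"
        using partial[OF x e'(2,1) q'(1) q(1)] a unfolding fx by blast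
      then show ?thesis using v q q' a by auto
    next
      assume a: "{q, ?f x} \<notin> E" "{q', ?f x} \<notin> E"
      then have "c {q, ?f x} \<noteq> c {q', ?f x}"
        using p ne proper_onD[OF c(1), of "{q, ?f x}" "{q', ?f x}" "?f x"] by auto
      then show ?thesis using v q q' a by auto
    qed
  qed
  ultimately have "edge_coloring G K c'" unfolding edge_coloring_def by blast
  then show ?thesis by blast
qed

lemma obtain_folding:
  assumes "card SB \<le> card SA"
  obtains \<sigma> where "inj_on \<sigma> (SB - SA)" "\<sigma> ` (SB - SA) \<subseteq> SA - SB"
proof -
  have "card (SB - SA) \<le> card (SA - SB)" using card_le_sym_Diff[OF fin(3,2) assms] .
  then show ?thesis using card_le_inj[of "SB - SA" "SA - SB"] fin that by auto
qed

lemma obtain_folding_onto: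
  assumes "card SB \<le> card SA" "s \<in> SB - SA" "j \<in> SA - SB"
  obtains \<sigma> where "inj_on \<sigma> (SB - SA)" "\<sigma> ` (SB - SA) \<subseteq> SA - SB" "\<sigma> s = j"
proof -
  have "card (SB - SA) \<le> card (SA - SB)" using card_le_sym_Diff[OF fin(3,2) assms(1)] .
  then have "card (SB - SA - {s}) \<le> card (SA - SB - {j})" using assms(2,3) fin by simp
  then obtain \<rho> where "\<rho> ` (SB - SA - {s}) \<subseteq> SA - SB - {j}" "inj_on \<rho> (SB - SA - {s})"
    using card_le_inj[of "SB - SA - {s}" "SA - SB - {j}"] fin by auto
  then have "inj_on (\<rho>(s := j)) (SB - SA)" "(\<rho>(s := j)) ` (SB - SA) \<subseteq> SA - SB"
    using assms(3) unfolding inj_on_def by auto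
  then show ?thesis using that by simp
qed

lemma odd_edge_coloring:
  assumes "card SB \<le> card SA" "card (Q \<union> SA) \<le> K + 1" "odd K"
  shows "\<exists>c. edge_coloring G K c"
proof -
  obtain \<sigma> where \<sigma>: "inj_on \<sigma> (SB - SA)" "\<sigma> ` (SB - SA) \<subseteq> SA - SB" by (rule obtain_folding[OF assms(1)])
  obtain c where "proper_on (pairs (Q \<union> SA)) c" "c ` pairs (Q \<union> SA) \<subseteq> {..<K}"
    using odd_coloring_complete_graph[OF _ assms(2,3)] fin by auto
  then show ?thesis
    using pull_back_coloring[OF \<sigma>, of "{}" c K "\<lambda>_. 0"] by (auto simp: incidences_def)
qed

end

section \<open>Even maximum degree\<close>

text \<open>
  Whole elements are taken until the next one, \<open>t\<close>, would reach or exceed \<open>x\<close>.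
\<close>
lemma greedy_fill:
  fixes w :: "'b \<Rightarrow> nat"
  assumes "finite T" "1 \<le> x" "x \<le> sum w T"
  shows "\<exists>Y\<subseteq>T. \<exists>t\<in>T - Y. sum w Y \<le> x \<and> x \<le> sum w Y + w t"
  using assms(1,3)
proof (induction T)
  case empty
  then show ?case using assms(2) by simp
next
  case (insert t T)
  show ?case
  proof (cases "x \<le> sum w T")
    case True
    then show ?thesis using insert.IH by blast
  next
    case False
    then show ?thesis using insert by (intro exI[of _ T] conjI bexI[of _ t]) (auto simp: add.commute)
  qed
qed

definition nbrs_in :: "'a graph \<Rightarrow> 'a set \<Rightarrow> 'a \<Rightarrow> 'a set" where
  "nbrs_in G Q s = {q \<in> Q. {q, s} \<in> edges G}"

context two_sided_split
begin

lemma nbrs_A: "s \<in> SA - SB \<Longrightarrow> nbrs_in G Q s \<subseteq> A"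
  using neighbor_cases not_in_S unfolding nbrs_in_def by blast

lemma nbrs_B: "s \<in> SB - SA \<Longrightarrow> nbrs_in G Q s \<subseteq> B"
  using neighbor_cases not_in_S unfolding nbrs_in_def by blast

lemma finite_nbrs: "finite (nbrs_in G Q s)"
  using fin(1) unfolding nbrs_in_def by simp

lemma SA_stable: "pairs SA \<inter> edges G = {}"
proof -
  have False if e: "e \<in> pairs SA" "e \<in> edges G" for e
  proof -
    obtain q y where "q \<in> Q" "e = {q, y}" "q \<noteq> y" by (rule edge_has_end_in_Q[OF e(2)])
    then show False using e(1) not_in_S unfolding pairs_def by auto
  qed
  then show ?thesis by blast
qed

text \<open>
  The images of the edges at \<open>X\<close>, for \<open>X\<close> a subset of \<open>SB - SA\<close>. They are non-edges of \<open>G\<close> that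
  folding turns into edges.
\<close>
definition folded_pairs :: "('a \<Rightarrow> 'a) \<Rightarrow> 'a set \<Rightarrow> 'a set set" where
  "folded_pairs \<sigma> X = (\<lambda>(s, q). {q, \<sigma> s}) ` (SIGMA s:X. nbrs_in G Q s)"

lemma folded_pairs_iff:
  assumes "inj_on \<sigma> (SB - SA)" "\<sigma> ` (SB - SA) \<subseteq> SA - SB" "X \<subseteq> SB - SA" "s \<in> SB - SA" "q \<in> Q"
  shows "{q, \<sigma> s} \<in> folded_pairs \<sigma> X \<longleftrightarrow> s \<in> X \<and> {q, s} \<in> edges G"
proof
  assume "{q, \<sigma> s} \<in> folded_pairs \<sigma> X"
  then obtain t p where t: "t \<in> X" "p \<in> nbrs_in G Q t" "{q, \<sigma> s} = {p, \<sigma> t}"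
    unfolding folded_pairs_def by auto
  have p: "p \<in> Q" "{p, t} \<in> edges G" using t(2) unfolding nbrs_in_def by auto
  have "\<sigma> s \<in> SA" "\<sigma> t \<in> SA" using assms(2-4) t(1) by blast+
  then have "\<sigma> s \<notin> Q" "\<sigma> t \<notin> Q" using not_in_S by blast+
  then have "q = p" "\<sigma> s = \<sigma> t" using t(3) p(1) assms(5) by (metis doubleton_eq_iff)+
  moreover have "s = t" using inj_onD[OF assms(1) \<open>\<sigma> s = \<sigma> t\<close>] assms(3,4) t(1) by blast
  ultimately show "s \<in> X \<and> {q, s} \<in> edges G" using t(1) p(2) by simp
next
  assume "s \<in> X \<and> {q, s} \<in> edges G"
  then show "{q, \<sigma> s} \<in> folded_pairs \<sigma> X"
    using assms(5) unfolding folded_pairs_def nbrs_in_def by force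
qed

lemma folded_pairs_nonedges:
  assumes "\<sigma> ` (SB - SA) \<subseteq> SA - SB" "X \<subseteq> SB - SA"
  shows "folded_pairs \<sigma> X \<subseteq> pairs (Q \<union> SA) - edges G"
proof
  fix e assume "e \<in> folded_pairs \<sigma> X"
  then obtain s q where s: "s \<in> X" "q \<in> nbrs_in G Q s" "e = {q, \<sigma> s}" unfolding folded_pairs_def by auto
  have q: "q \<in> Q" "q \<in> B" using s nbrs_B[of s] assms(2) unfolding nbrs_in_def by auto
  have \<sigma>s: "\<sigma> s \<in> SA - SB" using assms s(1) by blast
  then have "\<sigma> s \<notin> Q" using not_in_S by blast
  have "q \<notin> A" using q(2) AB(3) by blast
  then have "{q, \<sigma> s} \<notin> edges G" using neighbor_cases[of q "\<sigma> s"] q \<sigma>s \<open>\<sigma> s \<notin> Q\<close> by blast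
  then show "e \<in> pairs (Q \<union> SA) - edges G" using s(3) q \<sigma>s \<open>\<sigma> s \<notin> Q\<close> by auto
qed

lemma card_folded_pairs:
  assumes "inj_on \<sigma> (SB - SA)" "\<sigma> ` (SB - SA) \<subseteq> SA - SB" "X \<subseteq> SB - SA"
  shows "card (folded_pairs \<sigma> X) = (\<Sum>s\<in>X. card (nbrs_in G Q s))"
proof -
  have "inj_on (\<lambda>(s, q). {q, \<sigma> s}) (SIGMA s:X. nbrs_in G Q s)"
  proof (rule inj_onI, clarify)
    fix s q t p assume a: "s \<in> X" "q \<in> nbrs_in G Q s" "t \<in> X" "p \<in> nbrs_in G Q t" "{q, \<sigma> s} = {p, \<sigma> t}"
    have "\<sigma> s \<in> SA" "\<sigma> t \<in> SA" using assms(2,3) a(1,3) by blast+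
    then have "\<sigma> s \<notin> Q" "\<sigma> t \<notin> Q" using not_in_S by blast+
    moreover have "q \<in> Q" "p \<in> Q" using a(2,4) unfolding nbrs_in_def by auto
    ultimately have "q = p" "\<sigma> s = \<sigma> t" using a(5) by (metis doubleton_eq_iff)+
    then show "s = t \<and> q = p" using inj_onD[OF assms(1)] assms(3) a(1,3) by blast
  qed
  then have "card (folded_pairs \<sigma> X) = card (SIGMA s:X. nbrs_in G Q s)"
    unfolding folded_pairs_def by (rule card_image)
  also have "\<dots> = (\<Sum>s\<in>X. card (nbrs_in G Q s))"
    using assms(3) fin(3) finite_nbrs by (intro card_SigmaI) (auto intro: finite_subset)
  finally show ?thesis .
qed

text \<open>
  A set \<open>E\<close> of \<open>h\<close> non-edges of \<open>Q \<union> SA\<close> is wanted to which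
  \<open>color_sparse_complement_with_spare_colors\<close> applies. If \<open>h\<close> non-edges are left after folding,
  they can serve. Otherwise \<open>E\<close> consists of all that are left, filled up with folded pairs:
  those of whole vertices \<open>s\<close> of \<open>SB - SA\<close>, whose edges then all get reserved colors, and a part
  \<open>F\<close> of those of one last vertex \<open>t\<close>. The vertex \<open>t\<close> is folded onto a vertex \<open>j\<close> with at least
  as many neighbors, which gives the colors reserved at \<open>F\<close> enough edges between \<open>j\<close> and \<open>A\<close> to
  be used on, away from the edges that represent \<open>t\<close>.
\<close>
lemma even_edge_coloring:
  assumes clique: "pairs Q \<subseteq> edges G" and cardV: "card (Q \<union> SA) = 2 * h + 1" and h: "1 \<le> h"
    and SBSA: "card SB \<le> card SA"
    and sparse: "h \<le> card (pairs (Q \<union> SA) - edges G)"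
    and crowded: "card (pairs (Q \<union> SA) - edges G) < h + (\<Sum>s\<in>SB - SA. card (nbrs_in G Q s)) \<Longrightarrow>
      \<exists>j\<in>SA - SB. \<forall>s\<in>SB - SA. card (nbrs_in G Q s) \<le> card (nbrs_in G Q j)"
  shows "\<exists>c. edge_coloring G (2 * h) c"
proof -
  let ?V = "Q \<union> SA" and ?T = "SB - SA"
  let ?M = "pairs ?V - edges G" and ?w = "\<lambda>s. card (nbrs_in G Q s)"
  have finV: "finite ?V" using fin by simp
  have finM: "finite ?M" using finite_pairs[OF finV] by simp
  have finT: "finite ?T" using fin by simp
  have meets: "e \<inter> SA \<noteq> {}" if "e \<in> ?M" for e using that clique unfolding pairs_def by blast
  have SAM: "pairs SA \<subseteq> ?M" using SA_stable pairs_mono[of SA ?V] by blast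
  have SAF: "pairs SA \<inter> folded_pairs \<sigma> X = {}" for \<sigma> X
  proof -
    have "\<exists>q\<in>Q. q \<in> e" if "e \<in> folded_pairs \<sigma> X" for e
      using that unfolding folded_pairs_def nbrs_in_def by auto
    then show ?thesis using not_in_S unfolding pairs_def by blast
  qed
  show ?thesis
  proof (cases "card ?M < h + sum ?w ?T")
    case False
    obtain \<sigma> where \<sigma>: "inj_on \<sigma> ?T" "\<sigma> ` ?T \<subseteq> SA - SB" by (rule obtain_folding[OF SBSA])
    let ?N = "?M - folded_pairs \<sigma> ?T"
    have "card ?N = card ?M - card (folded_pairs \<sigma> ?T)"
      using folded_pairs_nonedges[OF \<sigma>(2)] finM by (intro card_Diff_subset) (auto intro: finite_subset)
    then have "h \<le> card ?N" using False card_folded_pairs[OF \<sigma>] by simp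
    have "\<exists>E\<subseteq>?N. card E = h \<and> card (\<Union>E) \<le> h + 1"
    proof (rule connected_subset_few_vertices[of ?N ?V SA h])
      show "finite ?N" using finM by simp
      show "?N \<subseteq> pairs ?V" by blast
      show "pairs SA \<subseteq> ?N" using SAM SAF by blast
      show "e \<inter> SA \<noteq> {}" if "e \<in> ?N" for e using meets that by blast
    qed fact+
    then obtain E where E: "E \<subseteq> ?N" "card E = h" "card (\<Union>E) \<le> h + 1" by blast
    have EV: "E \<subseteq> pairs ?V" using E(1) by blast
    (* all edges keep their images, so there is nothing to reserve at any vertex j *)
    obtain c g where c: "proper_on (pairs ?V - E) c" "c ` (pairs ?V - E) \<subseteq> {..<2 * h}"
      and g: "bij_betw g (incidences E) {..<2 * h}"
      and spare: "\<forall>f\<in>pairs ?V - E. \<forall>x\<in>f. \<forall>e\<in>E. x \<in> e \<longrightarrow> c f \<noteq> g (x, e)"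
      using color_sparse_complement_with_spare_colors[OF finV cardV EV E(2,3) h, of "{}" undefined "{}"]
      by simp blast
    show ?thesis
    proof (rule pull_back_coloring[OF \<sigma> _ c])
      show "E \<inter> edges G = {}" using E(1) by blast
      show "inj_on g (incidences E)" "g ` incidences E \<subseteq> {..<2 * h}" using g unfolding bij_betw_def by auto
      show "c f \<noteq> g (x, e)" if "f \<in> pairs ?V - E" "x \<in> f" "e \<in> E" "x \<in> e" for f x e
        using spare that by blast
      show "c {q', \<sigma> s} \<noteq> g (q, {q, \<sigma> s})"
        if "s \<in> ?T" "{q, s} \<in> edges G" "q \<in> Q" "{q, \<sigma> s} \<in> E" for q q' s
        using folded_pairs_iff[OF \<sigma> subset_refl that(1,3)] that E(1) by blast
    qed
  next
    case True
    then obtain j where j: "j \<in> SA - SB" "\<forall>s\<in>?T. ?w s \<le> ?w j" using crowded by blast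
    (* the number of folded pairs that E lacks *)
    define x where "x = h + sum ?w ?T - card ?M"
    have x: "1 \<le> x" "x \<le> sum ?w ?T" using True sparse unfolding x_def by linarith+
    obtain Y t where Y: "Y \<subseteq> ?T" "t \<in> ?T - Y" "sum ?w Y \<le> x" "x \<le> sum ?w Y + ?w t"
      using greedy_fill[OF finT x] by blast
    have tT: "t \<in> ?T" using Y(2) by blast
    obtain \<sigma> where \<sigma>: "inj_on \<sigma> ?T" "\<sigma> ` ?T \<subseteq> SA - SB" "\<sigma> t = j"
      by (rule obtain_folding_onto[OF SBSA tT j(1)])
    have "x - sum ?w Y \<le> ?w t" using Y(4) by simp
    then obtain F where F: "F \<subseteq> nbrs_in G Q t" "card F = x - sum ?w Y"
      using obtain_subset_with_card_n by metis
    have FQ: "F \<subseteq> Q" using F(1) unfolding nbrs_in_def by blast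
    have jQ: "j \<notin> Q" using j(1) not_in_S by blast
    define Z where "Z = folded_pairs \<sigma> Y \<union> (\<lambda>q. {q, j}) ` F"
    let ?P = "folded_pairs \<sigma> ?T"
    have ZP: "Z \<subseteq> ?P"
    proof -
      have "folded_pairs \<sigma> Y \<subseteq> ?P" using Y(1) unfolding folded_pairs_def by auto
      moreover have "{q, j} \<in> ?P" if "q \<in> F" for q
        using folded_pairs_iff[OF \<sigma>(1,2) subset_refl tT, of q] that F(1) \<sigma>(3) tT unfolding nbrs_in_def by auto
      ultimately show ?thesis unfolding Z_def by blast
    qed
    have PM: "?P \<subseteq> ?M" by (rule folded_pairs_nonedges[OF \<sigma>(2) subset_refl])
    have finP: "finite ?P" using PM finM finite_subset by blast
    have cardP: "card ?P = sum ?w ?T" by (rule card_folded_pairs[OF \<sigma>(1,2) subset_refl])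
    have cardZ: "card Z = x"
    proof -
      have "inj_on (\<lambda>q. {q, j}) F" by (auto simp: inj_on_def doubleton_eq_iff)
      then have "card ((\<lambda>q. {q, j}) ` F) = x - sum ?w Y" using F(2) by (simp add: card_image)
      moreover have "card (folded_pairs \<sigma> Y) = sum ?w Y" by (rule card_folded_pairs[OF \<sigma>(1,2) Y(1)])
      moreover have "{q, j} \<notin> folded_pairs \<sigma> Y" if "q \<in> F" for q
        using folded_pairs_iff[OF \<sigma>(1,2) Y(1) tT, of q] that FQ \<sigma>(3) Y(2) by auto
      then have "folded_pairs \<sigma> Y \<inter> (\<lambda>q. {q, j}) ` F = {}" by blast
      then have "card Z = card (folded_pairs \<sigma> Y) + card ((\<lambda>q. {q, j}) ` F)"
        unfolding Z_def using ZP finP unfolding Z_def by (intro card_Un_disjoint) (auto intro: finite_subset)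
      ultimately show ?thesis using Y(3) by simp
    qed
    define E where "E = (?M - ?P) \<union> Z"
    have EM: "E \<subseteq> ?M" unfolding E_def using ZP PM by blast
    have finE: "finite E" using EM finM finite_subset by blast
    have cardE: "card E = h"
    proof -
      have "card E = card (?M - ?P) + card Z"
        unfolding E_def using ZP finP finM by (intro card_Un_disjoint) (auto intro: finite_subset)
      moreover have "card (?M - ?P) = card ?M - card ?P" using PM finP by (intro card_Diff_subset)
      moreover have "card ?P \<le> card ?M" using PM finM by (rule card_mono[rotated])
      ultimately show ?thesis using cardZ cardP sparse True unfolding x_def by linarith
    qed
    have "pairs SA \<subseteq> E" unfolding E_def using SAM SAF by blast
    moreover have "E \<subseteq> pairs ?V" using EM by blast
    moreover have "e \<inter> SA \<noteq> {}" if "e \<in> E" for e using meets EM that by blast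
    ultimately have "\<exists>E'\<subseteq>E. card E' = h \<and> card (\<Union>E') \<le> h + 1"
      using cardE by (intro connected_subset_few_vertices[OF finE _ _ _ h]) auto
    then obtain E' where E': "E' \<subseteq> E" "card E' = h" "card (\<Union>E') \<le> h + 1" by blast
    then have "E' = E" using cardE finE by (metis card_subset_eq)
    then have UE: "card (\<Union>E) \<le> h + 1" using E'(3) by simp
    define L where "L = nbrs_in G Q j"
    have LA: "L \<subseteq> A" unfolding L_def by (rule nbrs_A[OF j(1)])
    have FE: "{f, j} \<in> E" if "f \<in> F" for f using that unfolding E_def Z_def by blast
    have LE: "{j, y} \<notin> E" if "y \<in> L" for y
      using that EM unfolding L_def nbrs_in_def by (auto simp: insert_commute)
    have "card F \<le> ?w t" using F(1) finite_nbrs by (intro card_mono) auto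
    then have FL: "card F \<le> card L" using j(2) tT unfolding L_def by force
    have LV: "L \<subseteq> ?V" "j \<notin> L" using jQ unfolding L_def nbrs_in_def by auto
    have "\<exists>c g. proper_on (pairs ?V - E) c \<and> c ` (pairs ?V - E) \<subseteq> {..<2 * h} \<and>
      bij_betw g (incidences E) {..<2 * h} \<and>
      (\<forall>f\<in>pairs ?V - E. \<forall>x\<in>f. \<forall>e\<in>E. x \<in> e \<longrightarrow> c f \<noteq> g (x, e)) \<and>
      (\<forall>f\<in>F. \<forall>y\<in>?V - L. y \<noteq> j \<and> {j, y} \<notin> E \<longrightarrow> c {j, y} \<noteq> g (f, {f, j}))"
      by (rule color_sparse_complement_with_spare_colors)
        (fact finV cardV \<open>E \<subseteq> pairs ?V\<close> cardE UE h FE LV LE FL)+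
    then obtain c g where c: "proper_on (pairs ?V - E) c" "c ` (pairs ?V - E) \<subseteq> {..<2 * h}"
      and g: "bij_betw g (incidences E) {..<2 * h}"
      and spare: "\<forall>f\<in>pairs ?V - E. \<forall>x\<in>f. \<forall>e\<in>E. x \<in> e \<longrightarrow> c f \<noteq> g (x, e)"
      and reserved: "\<forall>f\<in>F. \<forall>y\<in>?V - L. y \<noteq> j \<and> {j, y} \<notin> E \<longrightarrow> c {j, y} \<noteq> g (f, {f, j})"
      by (elim exE conjE)
    show ?thesis
    proof (rule pull_back_coloring[OF \<sigma>(1,2) _ c])
      show "E \<inter> edges G = {}" using EM by blast
      show "inj_on g (incidences E)" "g ` incidences E \<subseteq> {..<2 * h}" using g unfolding bij_betw_def by auto
      show "c f \<noteq> g (x, e)" if "f \<in> pairs ?V - E" "x \<in> f" "e \<in> E" "x \<in> e" for f x e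
        using spare that by blast
      show "c {q', \<sigma> s} \<noteq> g (q, {q, \<sigma> s})"
        if s: "s \<in> ?T" and q: "{q, s} \<in> edges G" "{q', s} \<in> edges G" "q \<in> Q" "q' \<in> Q"
          and qE: "{q, \<sigma> s} \<in> E" and q'E: "{q', \<sigma> s} \<notin> E" for q q' s
      proof -
        have "{q, \<sigma> s} \<in> ?P" using folded_pairs_iff[OF \<sigma>(1,2) subset_refl s q(3)] s q by blast
        then have qZ: "{q, \<sigma> s} \<in> Z" using qE unfolding E_def by blast
        have "s \<notin> Y"
          using folded_pairs_iff[OF \<sigma>(1,2) Y(1) s q(4)] q(2) q'E unfolding E_def Z_def by blast
        then have "{q, \<sigma> s} \<in> (\<lambda>q. {q, j}) ` F"
          using folded_pairs_iff[OF \<sigma>(1,2) Y(1) s q(3)] qZ unfolding Z_def by blast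
        then obtain f where f: "f \<in> F" "{q, \<sigma> s} = {f, j}" by blast
        then have qf: "q = f" "\<sigma> s = j" using q(3) jQ by (metis doubleton_eq_iff)+
        have "q' \<in> B" using nbrs_B[OF s] q(2,4) unfolding nbrs_in_def by blast
        then have "q' \<notin> L" using LA AB(3) by blast
        moreover have "q' \<noteq> j" using q(4) jQ by blast
        moreover have "{j, q'} \<notin> E" using q'E qf(2) by (simp add: insert_commute)
        ultimately have "c {j, q'} \<noteq> g (f, {f, j})" using reserved f(1) q(4) by blast
        then show ?thesis unfolding qf by (simp add: insert_commute)
      qed
    qed
  qed
qed

end

section \<open>Overfull neighborhoods\<close>

lemma finite_has_maximal_image:
  fixes w :: "'b \<Rightarrow> nat"
  assumes "finite X" "X \<noteq> {}"
  shows "\<exists>j\<in>X. \<forall>s\<in>X. w s \<le> w j"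
proof -
  have "Max (w ` X) \<in> w ` X" using assms by (intro Max_in) auto
  then obtain j where j: "j \<in> X" "w j = Max (w ` X)" by fastforce
  moreover have "w s \<le> Max (w ` X)" if "s \<in> X" for s using assms(1) that by (intro Max_ge) auto
  ultimately show ?thesis by (intro bexI[of _ j]) auto
qed

lemma degree_le_max_degree:
  assumes "finite (verts G)" "x \<in> verts G"
  shows "degree G x \<le> max_degree G"
  unfolding max_degree_def using assms by (intro Max_ge) auto

lemma max_degree_leI:
  assumes "finite (verts G)" "\<And>x. x \<in> verts G \<Longrightarrow> degree G x \<le> n"
  shows "max_degree G \<le> n"
  unfolding max_degree_def using assms by (subst Max_le_iff) auto

lemma finite_edges:
  assumes "finite_simple_graph G"
  shows "finite (edges G)"
  by (rule finite_subset[of _ "Pow (verts G)"]) (use assms in \<open>auto simp: finite_simple_graph_def\<close>)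

lemma degree_eq_card_neighbors:
  assumes "finite_simple_graph G"
  shows "degree G x = card {y. y \<noteq> x \<and> {x, y} \<in> edges G}"
  unfolding degree_def
  by (rule card_star[OF finite_edges[OF assms]]) (use assms in \<open>auto simp: finite_simple_graph_def\<close>)

lemma closed_neighborhood_eq:
  assumes "finite_simple_graph G"
  shows "closed_neighborhood G v = insert v {y. y \<noteq> v \<and> {v, y} \<in> edges G}"
proof -
  have "y \<in> verts G" if "{v, y} \<in> edges G" for y
    using assms that unfolding finite_simple_graph_def by blast
  then show ?thesis unfolding closed_neighborhood_def adjacent_def by auto
qed

lemma card_closed_neighborhood:
  assumes "finite_simple_graph G"
  shows "card (closed_neighborhood G v) = degree G v + 1"
proof -
  have "{y. y \<noteq> v \<and> {v, y} \<in> edges G} \<subseteq> verts G"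
    using assms unfolding finite_simple_graph_def by blast
  then have "finite {y. y \<noteq> v \<and> {v, y} \<in> edges G}"
    using assms finite_subset unfolding finite_simple_graph_def by blast
  then show ?thesis
    unfolding closed_neighborhood_eq[OF assms] degree_eq_card_neighbors[OF assms] by simp
qed

lemma edges_induced_subgraph:
  assumes "finite_simple_graph G"
  shows "edges (induced_subgraph G X) = edges G \<inter> pairs X"
  using assms unfolding induced_subgraph_def pairs_def finite_simple_graph_def by auto

lemma degree_induced_subgraph_le:
  assumes "finite_simple_graph G"
  shows "degree (induced_subgraph G X) x \<le> degree G x"
  unfolding degree_def edges_induced_subgraph[OF assms]
  using finite_edges[OF assms] by (intro card_mono) auto

lemma degree_center_closed_neighborhood:
  assumes "finite_simple_graph G"
  shows "degree (induced_subgraph G (closed_neighborhood G v)) v = degree G v"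
proof -
  have "e \<in> pairs (closed_neighborhood G v)" if e: "e \<in> edges G" "v \<in> e" for e
  proof -
    have "card e = 2" using assms e(1) unfolding finite_simple_graph_def by blast
    then have "e \<in> pairs e" unfolding pairs_def by simp
    then obtain y where "e = {v, y}" "y \<noteq> v" using e(2) pairs_other_end by metis
    then show ?thesis using e(1) unfolding closed_neighborhood_eq[OF assms] by auto
  qed
  then have "{e \<in> edges G \<inter> pairs (closed_neighborhood G v). v \<in> e} = {e \<in> edges G. v \<in> e}" by blast
  then show ?thesis unfolding degree_def edges_induced_subgraph[OF assms] by simp
qed

lemma card_color_class_le:
  assumes "finite X" "card X = 2 * h + 1" "E \<subseteq> pairs X" "proper_on E c"
  shows "card {e \<in> E. c e = k} \<le> h"
proof -
  have "finite E" using assms(1,3) finite_pairs finite_subset by blast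
  then have "2 * card {e \<in> E. c e = k} = card (\<Union>{e \<in> E. c e = k})"
    using assms(3,4) by (intro card_Union_color_class[symmetric]) (auto simp: pairs_def)
  also have "\<dots> \<le> card X" using assms(1,3) unfolding pairs_def by (intro card_mono) auto
  finally show ?thesis using assms(2) by linarith
qed

text \<open>
  A color class is a matching, so it has at most \<open>h\<close> edges inside a neighborhood with
  \<open>2 * h + 1\<close> vertices. The center keeps its degree in the induced subgraph, hence both graphs
  have maximum degree \<open>2 * h\<close>, and \<open>2 * h\<close> classes cannot hold all edges of the overfull
  subgraph.
\<close>
lemma overfull_neighborhood_uncolorable:
  assumes G: "finite_simple_graph G" and v: "v \<in> verts G" "degree G v = max_degree G"
    and over: "overfull (induced_subgraph G (closed_neighborhood G v))"
  shows "even (max_degree G) \<and> \<not> edge_coloring G (max_degree G) c"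
proof -
  let ?X = "closed_neighborhood G v"
  let ?H = "induced_subgraph G ?X"
  have vertsH: "verts ?H = ?X" unfolding induced_subgraph_def by simp
  have cardX: "card ?X = max_degree G + 1" using card_closed_neighborhood[OF G, of v] v(2) by simp
  then have finX: "finite ?X" by (simp add: card_ge_0_finite)
  have "odd (card ?X)" using over unfolding overfull_def vertsH by blast
  then have ev: "even (max_degree G)" using cardX by simp
  then obtain h where h: "max_degree G = 2 * h" by blast
  have "degree ?H v \<le> max_degree ?H"
  proof (rule degree_le_max_degree)
    show "finite (verts ?H)" using finX vertsH by simp
    have "v \<in> ?X" unfolding closed_neighborhood_def by simp
    then show "v \<in> verts ?H" using vertsH by simp
  qed
  then have "2 * h \<le> max_degree ?H" using degree_center_closed_neighborhood[OF G, of v] v(2) h by simp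
  then have "h * (2 * h) \<le> h * max_degree ?H" by simp
  moreover have "real (h * max_degree ?H) < real (card (edges ?H))"
    using over cardX unfolding overfull_def vertsH h by simp
  ultimately have many: "h * (2 * h) < card (edges ?H)" by linarith
  have "\<not> edge_coloring G (2 * h) c"
  proof
    assume c: "edge_coloring G (2 * h) c"
    have E: "edges ?H \<subseteq> pairs ?X" "edges ?H \<subseteq> edges G" unfolding edges_induced_subgraph[OF G] by auto
    have fin: "finite (edges ?H)" using E(2) finite_edges[OF G] finite_subset by blast
    have prp: "proper_on (edges ?H) c"
      using c E(2) unfolding edge_coloring_def proper_on_def by blast
    have "card (edges ?H) = (\<Sum>k<2 * h. card {e \<in> edges ?H. c e = k})"
    proof -
      have "c ` edges ?H \<subseteq> {..<2 * h}" using c E(2) unfolding edge_coloring_def by blast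
      then show ?thesis using sum.group[OF fin, of "{..<2 * h}" c "\<lambda>_. 1::nat"] by simp
    qed
    also have "\<dots> \<le> (\<Sum>k<2 * h. h)"
      by (intro sum_mono card_color_class_le[OF finX _ E(1) prp]) (use cardX h in simp)
    finally show False using many by simp
  qed
  then show ?thesis using ev h by simp
qed

lemma not_overfull_many_nonedges:
  assumes G: "finite_simple_graph G" and X: "finite X" "X \<subseteq> verts G" "card X = 2 * h + 1"
    and max: "max_degree G \<le> 2 * h" and over: "\<not> overfull (induced_subgraph G X)"
  shows "h \<le> card (pairs X - edges G)"
proof -
  let ?H = "induced_subgraph G X"
  have vertsH: "verts ?H = X" unfolding induced_subgraph_def by simp
  have "max_degree ?H \<le> 2 * h"
  proof (rule max_degree_leI)
    show "finite (verts ?H)" using X(1) vertsH by simp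
    fix x assume "x \<in> verts ?H"
    then have "degree G x \<le> max_degree G"
      using X(2) vertsH G by (intro degree_le_max_degree) (auto simp: finite_simple_graph_def)
    then show "degree ?H x \<le> 2 * h" using degree_induced_subgraph_le[OF G, of X x] max by linarith
  qed
  then have "h * max_degree ?H \<le> h * (2 * h)" by simp
  moreover have "real (card (edges ?H)) \<le> real (h * max_degree ?H)"
    using over X(3) unfolding overfull_def vertsH by simp
  ultimately have few: "card (edges G \<inter> pairs X) \<le> h * (2 * h)"
    unfolding edges_induced_subgraph[OF G] by linarith
  have "card (pairs X) = h * (2 * h + 1)"
    using card_pairs[OF X(1)] X(3) by (simp add: choose_two)
  moreover have "card (pairs X) = card (pairs X \<inter> edges G) + card (pairs X - edges G)"
    using finite_pairs[OF X(1)] by (rule card_Int_Diff)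
  ultimately show ?thesis using few by (simp add: Int_commute algebra_simps)
qed

lemma chromatic_index_le: "edge_coloring G k c \<Longrightarrow> chromatic_index G \<le> k"
  unfolding chromatic_index_def by (rule Least_le) blast

lemma class_2_iff_no_coloring:
  assumes "\<exists>c. edge_coloring G (Suc (max_degree G)) c"
  shows "class_2 G \<longleftrightarrow> (\<nexists>c. edge_coloring G (max_degree G) c)"
proof
  assume "class_2 G"
  then show "\<nexists>c. edge_coloring G (max_degree G) c"
    using chromatic_index_le[of G "max_degree G"] unfolding class_2_def by fastforce
next
  assume none: "\<nexists>c. edge_coloring G (max_degree G) c"
  obtain c where c: "edge_coloring G (chromatic_index G) c"
    unfolding chromatic_index_def using LeastI_ex[of "\<lambda>k. \<exists>c. edge_coloring G k c"] assms by blast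
  have "\<not> chromatic_index G \<le> max_degree G"
  proof
    assume "chromatic_index G \<le> max_degree G"
    then have "edge_coloring G (max_degree G) c" using c unfolding edge_coloring_def by fastforce
    then show False using none by blast
  qed
  moreover have "chromatic_index G \<le> Suc (max_degree G)" using assms chromatic_index_le by blast
  ultimately show "class_2 G" unfolding class_2_def by linarith
qed

context two_sided_split
begin

text \<open>
  The closed neighborhood of \<open>v\<close> is \<open>Q \<union> SA\<close>, on one vertex more than the maximum degree. What
  has to be checked before \<open>even_edge_coloring\<close> applies is the choice of \<open>j\<close>. If \<open>SA\<close> and \<open>SB\<close>
  have the same size, the two sides can be exchanged, and a vertex with most neighbors among
  those of \<open>SA - SB\<close> and \<open>SB - SA\<close> decides which side to fold. If \<open>SB\<close> is smaller, some vertex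
  of \<open>SA - SB\<close> is not used by the folding; in the crowded case it has more than \<open>h\<close> neighbors,
  all in \<open>A\<close>, which leaves fewer than \<open>h\<close> vertices for \<open>B\<close>.
\<close>
lemma class_2_iff_neighborhood_overfull:
  assumes G: "finite_simple_graph G" and verts: "verts G = Q \<union> S"
    and S: "SA \<union> SB \<subseteq> S"
    and clique: "pairs Q \<subseteq> edges G" and SBSA: "card SB \<le> card SA"
    and v: "v \<in> Q" "\<And>s. s \<in> SA \<Longrightarrow> {v, s} \<in> edges G"
    and w: "card SB = card SA \<Longrightarrow> \<exists>w\<in>Q. \<forall>s\<in>SB. {w, s} \<in> edges G"
  shows "class_2 G \<longleftrightarrow> neighborhood_overfull G"
proof -
  let ?D = "card Q - 1 + card SA"
  have finV: "finite (verts G)" using G unfolding finite_simple_graph_def by blast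
  have Qpos: "0 < card Q" using v(1) fin(1) by (auto simp: card_gt_0_iff)
  have disj: "Q \<inter> SA = {}" "Q \<inter> SB = {}" using not_in_S by blast+
  have nbhd: "{y. y \<noteq> q \<and> {q, y} \<in> edges G} = (Q - {q}) \<union> {s \<in> SA \<union> SB. {q, s} \<in> edges G}"
    if "q \<in> Q" for q
    using neighbor_cases[of q] clique that not_in_S by (auto simp: subset_iff)
  (* a vertex of Q sees only one of SA and SB, neither of which is larger than SA *)
  have outer: "card {s \<in> SA \<union> SB. {q, s} \<in> edges G} \<le> card SA" if q: "q \<in> Q" for q
  proof -
    have "{s \<in> SA \<union> SB. {q, s} \<in> edges G} \<subseteq> SA \<or> {s \<in> SA \<union> SB. {q, s} \<in> edges G} \<subseteq> SB"
      using neighbor_cases[of q] q AB(3) not_in_S by blast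
    then show ?thesis
    proof
      assume "{s \<in> SA \<union> SB. {q, s} \<in> edges G} \<subseteq> SB"
      from card_mono[OF fin(3) this] show ?thesis using SBSA by linarith
    qed (rule card_mono[OF fin(2)])
  qed
  have degQ: "degree G q \<le> ?D" if q: "q \<in> Q" for q
  proof -
    note outer[OF q]
    moreover have "degree G q \<le> card (Q - {q}) + card {s \<in> SA \<union> SB. {q, s} \<in> edges G}"
      unfolding degree_eq_card_neighbors[OF G] nbhd[OF q] by (rule card_Un_le)
    ultimately show ?thesis using fin(1) q by simp
  qed
  have degS: "degree G s \<le> ?D" if s: "s \<notin> Q" for s
  proof (cases "degree G s = 0")
    case False
    then have "{e \<in> edges G. s \<in> e} \<noteq> {}" unfolding degree_def by (metis card.empty)
    then obtain e where e: "e \<in> edges G" "s \<in> e" by blast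
    obtain q where "q \<in> Q" "e = {q, s}" "s \<in> SA \<union> SB" by (rule edge_end_in_Q[OF e s])
    then have "0 < card SA \<or> 0 < card SB" using fin(2,3) by (auto simp: card_gt_0_iff)
    then have "0 < card SA" using SBSA by linarith
    moreover have "{y. y \<noteq> s \<and> {s, y} \<in> edges G} \<subseteq> Q"
    proof clarify
      fix y assume y: "y \<noteq> s" "{s, y} \<in> edges G"
      obtain p where "p \<in> Q" "{s, y} = {p, s}" "s \<in> SA \<union> SB" by (rule edge_end_in_Q[OF y(2) _ s]) simp
      then show "y \<in> Q" using y(1) by (auto simp: doubleton_eq_iff)
    qed
    then have "degree G s \<le> card Q" unfolding degree_eq_card_neighbors[OF G] using fin(1) by (rule card_mono[rotated])
    ultimately show ?thesis using Qpos by linarith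
  qed simp
  have center: "closed_neighborhood G u = Q \<union> T \<and> degree G u = card Q - 1 + card T"
    if u: "u \<in> Q" "\<forall>s\<in>T. {u, s} \<in> edges G" and T: "T = SA \<or> T = SB" "card T = card SA" for u T
  proof -
    have "{s \<in> SA \<union> SB. {u, s} \<in> edges G} = T"
    proof (cases "T = {}")
      case False
      have sub: "T \<subseteq> {s \<in> SA \<union> SB. {u, s} \<in> edges G}" using u(2) T(1) by blast
      have "card {s \<in> SA \<union> SB. {u, s} \<in> edges G} \<le> card T" using outer[OF u(1)] T(2) by simp
      then show ?thesis using sub fin(2,3) by (intro card_seteq[symmetric]) auto
    next
      case True
      then have "SA = {}" "SB = {}" using T(2) SBSA fin(2,3) by auto
      then show ?thesis using True by blast
    qed
    then have eq: "{y. y \<noteq> u \<and> {u, y} \<in> edges G} = (Q - {u}) \<union> T" using nbhd[OF u(1)] by simp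
    have "card ((Q - {u}) \<union> T) = card (Q - {u}) + card T"
      using fin disj T(1) by (intro card_Un_disjoint) auto
    then show ?thesis
      unfolding closed_neighborhood_eq[OF G] degree_eq_card_neighbors[OF G] eq using u(1) fin(1) by auto
  qed
  have centerv: "closed_neighborhood G v = Q \<union> SA" "degree G v = ?D"
    using center[OF v(1), of SA] v(2) by auto
  have "max_degree G \<le> ?D" using degQ degS finV by (intro max_degree_leI) auto
  moreover have "?D \<le> max_degree G"
    using degree_le_max_degree[OF finV, of v] centerv(2) v(1) verts by simp
  ultimately have D: "max_degree G = ?D" by simp
  have cardV: "card (Q \<union> SA) = ?D + 1"
    using card_Un_disjoint[OF fin(1,2) disj(1)] Qpos by simp

  have colorable: "\<exists>c. edge_coloring G ?D c" if not_over: "\<not> neighborhood_overfull G"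
  proof (cases "even ?D")
    case False
    then show ?thesis using odd_edge_coloring[OF SBSA, of ?D] cardV by simp
  next
    case True
    then obtain h where h: "?D = 2 * h" by blast
    (* stated for both sides, because the fold may have to go the other way *)
    have sparse: "h \<le> card (pairs (Q \<union> T) - edges G)"
      if u: "u \<in> Q" "\<forall>s\<in>T. {u, s} \<in> edges G" and T: "T = SA \<or> T = SB" "card T = card SA" for u T
    proof (rule not_overfull_many_nonedges[OF G])
      show "finite (Q \<union> T)" using fin T by auto
      show "Q \<union> T \<subseteq> verts G" using verts S T(1) by auto
      have "card (Q \<union> T) = card Q + card T" using fin disj T(1) by (intro card_Un_disjoint) auto
      then show "card (Q \<union> T) = 2 * h + 1" using T(2) h Qpos by linarith
      show "max_degree G \<le> 2 * h" using D h by simp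
      have "degree G u = max_degree G" using center[OF u T] T(2) D by simp
      then show "\<not> overfull (induced_subgraph G (Q \<union> T))"
        using not_over center[OF u T] u(1) verts unfolding neighborhood_overfull_def by (metis UnI1)
    qed
    show ?thesis
    proof (cases "h = 0")
      case True
      have "edges G = {}"
      proof (rule ccontr)
        assume "edges G \<noteq> {}"
        then obtain e where e: "e \<in> edges G" by blast
        obtain q y where qy: "q \<in> Q" "e = {q, y}" "q \<noteq> y" by (rule edge_has_end_in_Q[OF e])
        then have "0 < degree G q"
          unfolding degree_def using e finite_edges[OF G] by (auto simp: card_gt_0_iff)
        then show False using degQ[OF qy(1)] h True by simp
      qed
      then show ?thesis unfolding edge_coloring_def by auto
    next
      case False
      then have h1: "1 \<le> h" by simp
      have cardV': "card (Q \<union> SA) = 2 * h + 1" using cardV h by simp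
      have sparseA: "h \<le> card (pairs (Q \<union> SA) - edges G)" using sparse[OF v(1), of SA] v(2) by blast
      let ?w = "\<lambda>s. card (nbrs_in G Q s)"
      show ?thesis
      proof (cases "\<exists>j\<in>SA - SB. \<forall>s\<in>SB - SA. ?w s \<le> ?w j")
        case True
        then show ?thesis using even_edge_coloring[OF clique cardV' h1 SBSA sparseA] h by simp
      next
        case noj: False
        show ?thesis
        proof (cases "card SB = card SA")
          case eq: True
          obtain u where u: "u \<in> Q" "\<forall>s\<in>SB. {u, s} \<in> edges G" using w[OF eq] by blast
          interpret swap: two_sided_split G Q B A SB SA
          proof
            show "e \<in> pairs Q \<or> (\<exists>q\<in>B. \<exists>s\<in>SB. e = {q, s}) \<or> (\<exists>q\<in>A. \<exists>s\<in>SA. e = {q, s})"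
              if "e \<in> edges G" for e using edge_cases[OF that] by blast
          qed (use fin AB QS in auto)
          have "card (Q \<union> SB) = 2 * h + 1"
            using card_Un_disjoint[OF fin(1,3) disj(2)] eq h Qpos by simp
          moreover have "h \<le> card (pairs (Q \<union> SB) - edges G)" using sparse[OF u] eq by simp
          moreover have "\<exists>j\<in>SB - SA. \<forall>s\<in>SA - SB. ?w s \<le> ?w j"
            if "card (pairs (Q \<union> SB) - edges G) < h + (\<Sum>s\<in>SA - SB. ?w s)"
          proof -
            have "SA - SB \<noteq> {}"
            proof
              assume "SA - SB = {}"
              then have "(\<Sum>s\<in>SA - SB. ?w s) = 0" by (metis sum.empty)
              then have "card (pairs (Q \<union> SB) - edges G) < h" using that by linarith
              then show False using sparse[OF u] eq by simp
            qed
            then obtain j where j: "j \<in> SA - SB" "\<forall>s\<in>SA - SB. ?w s \<le> ?w j"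
              using finite_has_maximal_image[of "SA - SB" ?w] fin(2) by blast
            then obtain t where "t \<in> SB - SA" "?w j < ?w t" using noj by (meson not_le)
            then show ?thesis using j(2) by (meson le_trans less_imp_le)
          qed
          ultimately show ?thesis
            using swap.even_edge_coloring[OF clique _ h1] eq h by simp
        next
          case False
          then have less: "card SB < card SA" using SBSA by simp
          let ?M = "pairs (Q \<union> SA) - edges G"
          have crowded: "\<exists>j\<in>SA - SB. \<forall>s\<in>SB - SA. ?w s \<le> ?w j"
            if few: "card ?M < h + (\<Sum>s\<in>SB - SA. ?w s)"
          proof -
            obtain \<sigma> where \<sigma>: "inj_on \<sigma> (SB - SA)" "\<sigma> ` (SB - SA) \<subseteq> SA - SB" by (rule obtain_folding[OF SBSA])
            have "card (\<sigma> ` (SB - SA)) < card (SA - SB)"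
              using card_less_sym_Diff[OF fin(3,2) less] \<sigma>(1) by (simp add: card_image)
            then have "\<not> SA - SB \<subseteq> \<sigma> ` (SB - SA)" 
              using card_mono[of "\<sigma> ` (SB - SA)" "SA - SB"] fin(3) by auto
            (* nothing is folded onto j, so the non-edges at j are not among the folded pairs *)
            then obtain j where j: "j \<in> SA - SB" "j \<notin> \<sigma> ` (SB - SA)" by blast
            let ?P = "folded_pairs \<sigma> (SB - SA)" and ?J = "{e \<in> ?M. j \<in> e}"
            have finV: "finite (Q \<union> SA)" and jV: "j \<in> Q \<union> SA" and jQ: "j \<notin> Q"
              using fin j(1) not_in_S by auto
            have finM: "finite ?M" using finite_pairs[OF finV] by simp
            have PM: "?P \<subseteq> ?M" by (rule folded_pairs_nonedges[OF \<sigma>(2) subset_refl])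
            have "?J \<inter> ?P = {}"
              using j(2) jQ unfolding folded_pairs_def nbrs_in_def by auto
            then have "card ?J + card ?P = card (?J \<union> ?P)"
              using finM PM by (intro card_Un_disjoint[symmetric]) (auto intro: finite_subset)
            also have "\<dots> \<le> card ?M" using PM finM by (intro card_mono) auto
            finally have "card ?J + (\<Sum>s\<in>SB - SA. ?w s) \<le> card ?M"
              unfolding card_folded_pairs[OF \<sigma> subset_refl] .
            moreover have "2 * h \<le> card ?J + ?w j"
            proof -
              have "{e \<in> edges G \<inter> pairs (Q \<union> SA). j \<in> e} \<subseteq> (\<lambda>q. {q, j}) ` nbrs_in G Q j"
              proof
                fix e assume "e \<in> {e \<in> edges G \<inter> pairs (Q \<union> SA). j \<in> e}"
                then have e: "e \<in> edges G" "j \<in> e" by auto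
                obtain q where "q \<in> Q" "e = {q, j}" "j \<in> SA \<union> SB" by (rule edge_end_in_Q[OF e jQ])
                then show "e \<in> (\<lambda>q. {q, j}) ` nbrs_in G Q j" using e(1) unfolding nbrs_in_def by auto
              qed
              then have "card {e \<in> edges G \<inter> pairs (Q \<union> SA). j \<in> e} \<le> ?w j"
                using finite_nbrs by (meson card_image_le card_mono finite_imageI le_trans)
              moreover have "pairs (Q \<union> SA) - edges G \<inter> pairs (Q \<union> SA) = ?M" by blast
              ultimately show ?thesis
                using card_pairs_minus_at[OF finV jV, of "edges G \<inter> pairs (Q \<union> SA)"] cardV' by simp
            qed
            ultimately have wj: "h < ?w j" using few by linarith
            have "card A + card B = card (A \<union> B)"
              using AB fin(1) by (intro card_Un_disjoint[symmetric]) (auto intro: finite_subset)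
            also have "\<dots> \<le> card Q" using AB fin(1) by (intro card_mono) auto
            also have "\<dots> \<le> 2 * h" using h less Qpos by linarith
            finally have "card A + card B \<le> 2 * h" .
            moreover have finAB: "finite A" "finite B" using AB fin(1) finite_subset by blast+
            moreover have "?w j \<le> card A" using card_mono[OF finAB(1) nbrs_A[OF j(1)]] .
            moreover have "?w s \<le> card B" if "s \<in> SB - SA" for s using card_mono[OF finAB(2) nbrs_B[OF that]] .
            ultimately have "?w s \<le> ?w j" if "s \<in> SB - SA" for s using wj that by fastforce
            then show ?thesis using j(1) by blast
          qed
          show ?thesis using even_edge_coloring[OF clique cardV' h1 SBSA sparseA crowded] h by simp
        qed
      qed
    qed
  qed
  have upper: "\<exists>c. edge_coloring G (Suc ?D) c"
  proof (cases "odd ?D")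
    case True
    then obtain c where c: "edge_coloring G ?D c" using odd_edge_coloring[OF SBSA, of ?D] cardV by auto
    have "edge_coloring G (Suc ?D) c"
      using c unfolding edge_coloring_def by (meson lessThan_subset_iff le_SucI order_refl subset_trans)
    then show ?thesis by blast
  next
    case False
    then show ?thesis using odd_edge_coloring[OF SBSA, of "Suc ?D"] cardV by simp
  qed
  have "\<not> edge_coloring G ?D c" if over: "neighborhood_overfull G" for c
  proof -
    obtain u where u: "u \<in> verts G" "degree G u = max_degree G"
      "overfull (induced_subgraph G (closed_neighborhood G u))"
      using over unfolding neighborhood_overfull_def by blast
    show ?thesis using overfull_neighborhood_uncolorable[OF G u, of c] D by simp
  qed
  then show ?thesis using class_2_iff_no_coloring[of G] upper colorable unfolding D by blast
qed

end

section \<open>Transitive orientations of split graphs\<close>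

lemma adjacent_irrefl: "finite_simple_graph G \<Longrightarrow> \<not> adjacent G x x"
  unfolding adjacent_def finite_simple_graph_def by fastforce

lemma adjacent_sym: "adjacent G x y \<longleftrightarrow> adjacent G y x"
  unfolding adjacent_def by (simp add: insert_commute)

text \<open>
  Transitivity would give an arc between two vertices of the stable set.
\<close>
lemma no_stable_path:
  assumes "finite_simple_graph G" "orientation G D" "trans D" "stable_set G S"
    and "s \<in> S" "t \<in> S" "(s, q) \<in> D"
  shows "(q, t) \<notin> D"
proof
  assume "(q, t) \<in> D"
  then have "(s, t) \<in> D" using assms(3,7) by (meson transD)
  then have "adjacent G s t" using assms(2) unfolding orientation_def by blast
  then show False
    using assms(4-6) adjacent_irrefl[OF assms(1)] unfolding stable_set_def pairwise_def by metis
qed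

text \<open>
  No vertex of \<open>A\<close> has an arc from \<open>S\<close>, so an arc from \<open>p\<close> to \<open>q\<close> within \<open>A\<close> makes every
  neighbor of \<open>q\<close> in \<open>S\<close> one of \<open>p\<close>, too. As \<open>A\<close> is a clique, the neighborhoods in \<open>S\<close> form a
  chain.
\<close>
lemma dominating_tail_vertex:
  assumes G: "finite_simple_graph G" and D: "orientation G D" "trans D"
    and Q: "clique G Q" and S: "stable_set G S"
    and A: "A = {q \<in> Q. \<exists>s\<in>S. (q, s) \<in> D}" "A \<noteq> {}"
  shows "\<exists>v\<in>A. \<forall>q\<in>A. \<forall>s\<in>S. adjacent G q s \<longrightarrow> adjacent G v s"
proof -
  let ?N = "\<lambda>q. {s \<in> S. adjacent G q s}"
  have finV: "finite (verts G)" using G unfolding finite_simple_graph_def by blast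
  have "finite Q" "finite S"
    using Q S finV unfolding clique_def stable_set_def by (auto intro: finite_subset)
  then have finA: "finite A" and finN: "finite (?N q)" for q using A(1) by auto
  have out: "(q, s) \<in> D" if q: "q \<in> A" and s: "s \<in> S" "adjacent G q s" for q s
  proof -
    obtain t where "t \<in> S" "(q, t) \<in> D" using q A(1) by blast
    then have "(s, q) \<notin> D" using no_stable_path[OF G D S s(1)] by blast
    then show ?thesis using D(1) s(2) adjacent_sym[of G q s] unfolding orientation_def by blast
  qed
  have chain: "?N q \<subseteq> ?N p" if "(p, q) \<in> D" "p \<in> A" "q \<in> A" for p q
  proof
    fix s assume "s \<in> ?N q"
    then have s: "s \<in> S" "(q, s) \<in> D" using out[OF that(3)] by auto
    then have "(p, s) \<in> D" using that(1) D(2) by (meson transD)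
    then show "s \<in> ?N p" using s(1) D(1) unfolding orientation_def by blast
  qed
  obtain v where v: "v \<in> A" "\<forall>q\<in>A. card (?N q) \<le> card (?N v)"
    using finite_has_maximal_image[OF finA A(2), of "\<lambda>q. card (?N q)"] by blast
  have "?N q \<subseteq> ?N v" if q: "q \<in> A" for q
  proof (cases "q = v")
    case False
    then have "adjacent G v q" using Q q v(1) A(1) unfolding clique_def pairwise_def by auto
    then have "(v, q) \<in> D \<or> (q, v) \<in> D" using D(1) unfolding orientation_def by blast
    then show ?thesis
    proof
      assume "(q, v) \<in> D"
      then have "?N v \<subseteq> ?N q" using chain q v(1) by blast
      then have "?N v = ?N q" using v(2) q finN by (intro card_seteq) auto
      then show ?thesis by blast
    qed (use chain q v(1) in blast)
  qed simp
  then show ?thesis using v(1) by blast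
qed

theorem theorem10:
  fixes G :: "'a graph" and Q S :: "'a set"
  assumes "finite_simple_graph G"
    and "split_comparability_graph G"
    and "verts G = Q \<union> S" and "Q \<inter> S = {}"
    and "maximal_clique G Q" and "stable_set G S"
    and "Q \<noteq> {}" and "S \<noteq> {}"
  shows "class_2 G \<longleftrightarrow> neighborhood_overfull G"
proof -
  note G = assms(1) and stable = assms(6)
  obtain D where D: "orientation G D" "trans D"
    using assms(2) unfolding split_comparability_graph_def comparability_graph_def by blast
  have Q: "clique G Q" using assms(5) unfolding maximal_clique_def by blast
  have fin: "finite Q" "finite S" using G assms(3) unfolding finite_simple_graph_def by auto
  have D': "orientation G (D\<inverse>)" "trans (D\<inverse>)"
  proof -
    show "orientation G (D\<inverse>)"
      using D(1) unfolding orientation_def converse_iff by (metis adjacent_sym)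
    show "trans (D\<inverse>)" using D(2) by simp
  qed
  define A where "A = {q \<in> Q. \<exists>s\<in>S. (q, s) \<in> D}"
  define B where "B = {q \<in> Q. \<exists>s\<in>S. (s, q) \<in> D}"
  define SA where "SA = {s \<in> S. \<exists>q\<in>A. {q, s} \<in> edges G}"
  define SB where "SB = {s \<in> S. \<exists>q\<in>B. {q, s} \<in> edges G}"
  have AB: "A \<inter> B = {}"
    using no_stable_path[OF G D stable] unfolding A_def B_def by blast
  have dom: "\<exists>v\<in>Q. \<forall>s\<in>T. {v, s} \<in> edges G"
    if T: "T = {s \<in> S. \<exists>q\<in>C. {q, s} \<in> edges G}"
      and C: "C = {q \<in> Q. \<exists>s\<in>S. (q, s) \<in> R}" and R: "orientation G R" "trans R" for T C R
  proof (cases "C = {}")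
    case True
    then show ?thesis using T assms(7) by blast
  next
    case False
    then obtain v where "v \<in> C" "\<forall>q\<in>C. \<forall>s\<in>S. adjacent G q s \<longrightarrow> adjacent G v s"
      using dominating_tail_vertex[OF G R Q stable C] by blast
    then show ?thesis using T C unfolding adjacent_def by (intro bexI[of _ v]) auto
  qed
  have domA: "\<exists>v\<in>Q. \<forall>s\<in>SA. {v, s} \<in> edges G" by (rule dom[OF SA_def A_def D])
  have domB: "\<exists>v\<in>Q. \<forall>s\<in>SB. {v, s} \<in> edges G"
    by (rule dom[OF SB_def _ D']) (auto simp: B_def)
  have cases: "e \<in> pairs Q \<or> (\<exists>q\<in>A. \<exists>s\<in>SA. e = {q, s}) \<or> (\<exists>q\<in>B. \<exists>s\<in>SB. e = {q, s})"
    if e: "e \<in> edges G" for e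
  proof (cases "e \<subseteq> Q")
    case True
    then show ?thesis using G e unfolding finite_simple_graph_def pairs_def by blast
  next
    case False
    have "e \<in> pairs (Q \<union> S)" using G e assms(3) unfolding finite_simple_graph_def pairs_def by auto
    obtain s where s: "s \<in> e" "s \<notin> Q" using False by blast
    obtain q where q: "e = {s, q}" "q \<in> Q \<union> S" "q \<noteq> s" "s \<in> Q \<union> S"
      by (rule pairs_other_end[OF \<open>e \<in> pairs (Q \<union> S)\<close> s(1)])
    have sS: "s \<in> S" using q(4) s(2) by blast
    have adj: "adjacent G q s" using e q(1) unfolding adjacent_def by (simp add: insert_commute)
    have "q \<notin> S" using stable adj sS q(3) unfolding stable_set_def pairwise_def by blast
    then have qQ: "q \<in> Q" using q(2) by blast
    have eq: "e = {q, s}" using q(1) by blast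
    have "(q, s) \<in> D \<or> (s, q) \<in> D" using D(1) adj unfolding orientation_def by blast
    then show ?thesis
    proof
      assume "(q, s) \<in> D"
      then have "q \<in> A" using qQ sS unfolding A_def by blast
      moreover have "s \<in> SA" using e eq sS \<open>q \<in> A\<close> unfolding SA_def by blast
      ultimately show ?thesis using eq by blast
    next
      assume "(s, q) \<in> D"
      then have "q \<in> B" using qQ sS unfolding B_def by blast
      moreover have "s \<in> SB" using e eq sS \<open>q \<in> B\<close> unfolding SB_def by blast
      ultimately show ?thesis using eq by blast
    qed
  qed
  have clique: "pairs Q \<subseteq> edges G"
    using Q unfolding clique_def pairwise_def adjacent_def by (auto simp: pairs_iff)
  have sub: "A \<subseteq> Q" "B \<subseteq> Q" "SA \<subseteq> S" "SB \<subseteq> S" unfolding A_def B_def SA_def SB_def by auto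
  have finS: "finite SA" "finite SB" using sub fin finite_subset by blast+
  show ?thesis
  proof (cases "card SB \<le> card SA")
    case True
    interpret two_sided_split G Q A B SA SB
    proof
      show "e \<in> pairs Q \<or> (\<exists>q\<in>A. \<exists>s\<in>SA. e = {q, s}) \<or> (\<exists>q\<in>B. \<exists>s\<in>SB. e = {q, s})"
        if "e \<in> edges G" for e by (rule cases[OF that])
    qed (use fin finS sub AB assms(4) in blast)+
    obtain v where v: "v \<in> Q" "\<forall>s\<in>SA. {v, s} \<in> edges G" using domA by blast
    show ?thesis
    proof (rule class_2_iff_neighborhood_overfull[OF G assms(3) _ clique True v(1)])
      show "SA \<union> SB \<subseteq> S" using sub by blast
      show "{v, s} \<in> edges G" if "s \<in> SA" for s using v(2) that by blast
      show "\<exists>w\<in>Q. \<forall>s\<in>SB. {w, s} \<in> edges G" by (rule domB)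
    qed
  next
    case False
    then have le: "card SA \<le> card SB" by simp
    interpret two_sided_split G Q B A SB SA
    proof
      show "e \<in> pairs Q \<or> (\<exists>q\<in>B. \<exists>s\<in>SB. e = {q, s}) \<or> (\<exists>q\<in>A. \<exists>s\<in>SA. e = {q, s})"
        if "e \<in> edges G" for e using cases[OF that] by blast
    qed (use fin finS sub AB assms(4) in blast)+
    obtain v where v: "v \<in> Q" "\<forall>s\<in>SB. {v, s} \<in> edges G" using domB by blast
    show ?thesis
    proof (rule class_2_iff_neighborhood_overfull[OF G assms(3) _ clique le v(1)])
      show "SB \<union> SA \<subseteq> S" using sub by blast
      show "{v, s} \<in> edges G" if "s \<in> SB" for s using v(2) that by blast
      show "\<exists>w\<in>Q. \<forall>s\<in>SA. {w, s} \<in> edges G" by (rule domA)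
    qed
  qed
qed

end
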